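(* Let $\mathcal{F}$ be a family of holomorphic functions on a domain $D\subset\mathbb{C}$, and let $k,m,n$ be three positive integers with $\frac{k+1}{m}+\frac{1}{n}<1$. Suppose that for each $f\in\mathcal{F}$, all zeros of $f$ are of multiplicity at least $m$ and all zeros of $f^{(k)}-1$ in $D$ are of multiplicity at least $n$. Then $\mathcal{F}$ is normal in $D$.
   Context: A family of holomorphic functions on a domain $D\subset\mathbb{C}$ is normal in $D$ if every sequence in the family has a subsequence which converges (spherically) uniformly on compact subsets of $D$ to a holomorphic function or to $\infty$. Here $f^{(k)}$ denotes the $k$-th derivative of $f$. *)

theory Defs
  imports "HOL-Complex_Analysis.Complex_Analysis" "HOL-Library.Extended_Nat"
begin

text \<open>
  A function that vanishes identically near \<open>z\<close> has a zero of infinite multiplicity there;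
  \<^const>\<open>zorder\<close> is unspecified in this case.  The value is meaningful only at zeros
  of functions holomorphic near \<open>z\<close>.
\<close>
definition zero_multiplicity :: "(complex \<Rightarrow> complex) \<Rightarrow> complex \<Rightarrow> enat" where
  "zero_multiplicity f z =
     (if \<forall>\<^sub>F w in nhds z. f w = 0 then \<infinity> else enat (nat (zorder f z)))"

text \<open>Chordal metric on the Riemann sphere, where \<^const>\<open>None\<close> is the point at infinity.\<close>
fun chordal :: "complex option \<Rightarrow> complex option \<Rightarrow> real" where
  "chordal (Some z) (Some w) = 2 * cmod (z - w) / (sqrt (1 + (cmod z)\<^sup>2) * sqrt (1 + (cmod w)\<^sup>2))"
| "chordal (Some z) None = 2 / sqrt (1 + (cmod z)\<^sup>2)"
| "chordal None (Some w) = 2 / sqrt (1 + (cmod w)\<^sup>2)"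
| "chordal None None = 0"

definition spherically_uniform_limit ::
    "complex set \<Rightarrow> (nat \<Rightarrow> complex \<Rightarrow> complex) \<Rightarrow> (complex \<Rightarrow> complex option) \<Rightarrow> bool" where
  "spherically_uniform_limit K s g \<longleftrightarrow>
     (\<forall>\<epsilon>>0. \<forall>\<^sub>F j in sequentially. \<forall>z\<in>K. chordal (Some (s j z)) (g z) < \<epsilon>)"

definition normal_family :: "complex set \<Rightarrow> (complex \<Rightarrow> complex) set \<Rightarrow> bool" where
  "normal_family D F \<longleftrightarrow>
     (\<forall>s :: nat \<Rightarrow> complex \<Rightarrow> complex. range s \<subseteq> F \<longrightarrow>
        (\<exists>(r :: nat \<Rightarrow> nat) g. strict_mono r \<and>
           ((\<exists>h. h holomorphic_on D \<and> g = (\<lambda>z. Some (h z))) \<or> g = (\<lambda>z. None)) \<and>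
           (\<forall>K. compact K \<and> K \<subseteq> D \<longrightarrow> spherically_uniform_limit K (\<lambda>j. s (r j)) g)))"

end

theory Submission
  imports Defs
begin

text \<open>
  Nevanlinna theory is replaced by Liouville's theorem for an explicit auxiliary function.  Rescaling
  \<open>f\<close> to \<open>g \<zeta> = f (z + \<rho> \<zeta>) / \<rho>\<^sup>k\<close> at a nearly worst point and scale of non-normality, as in the
  Zalcman-Pang lemma, yields \<open>g\<close> on a huge disc with \<open>\<bar>g'\<bar> \<le> C (1 + \<bar>g\<bar>) (1 + ln (1 + \<bar>g\<bar>\<^sup>2))\<close> there and
  \<open>\<bar>g'(0)\<bar>\<close> bounded below.  Let \<open>h\<close> be the \<open>k\<close>-th derivative of \<open>g\<close> and consider
  \<open>Q = h'\<^sup>N / (g\<^sup>a (h - 1)\<^sup>b)\<close> with \<open>a / N\<close> slightly below \<open>1 - (k + 1) / m\<close> and \<open>b / N\<close> slightly below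
  \<open>1 - 1 / n\<close>.  The multiplicities bound \<open>Q\<close> near its would-be poles.  The hypothesis on \<open>k, m, n\<close>
  says that \<open>a + b > N\<close> is possible, which makes \<open>Q\<close> small wherever \<open>g\<close> is large.  Hence \<open>Q\<close> is nearly
  constant and small, so \<open>g\<close> is nearly a polynomial of degree at most \<open>k\<close>.  Near a root of this
  polynomial all derivatives of \<open>g\<close> up to order \<open>k < m\<close> are small, which contradicts the lower bound on
  \<open>\<bar>g'(0)\<bar>\<close>.
\<close>

subsection \<open>Estimates of Cauchy and Harnack type\<close>

text \<open>The shape of the growth condition is dictated by the possible limit \<infinity>. On a
  disc inside Re z > 1 the functions exp (j z) form a normal family, yet |f'| = j |f| with ln |f| =
  j Re z, so no multiple of 1 + |f| bounds |f'| uniformly in j. The spherical weight 1 + |f|^2, on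
  the other hand, lets the differential inequality blow up along a segment. With the logarithm it
  integrates: ln (1 + ln (1 + |f|^2)) is Lipschitz, and on a disc of fixed small radius |f| stays
  below a power 1 + \<eta> of its central value. This \<eta>, and the \<eta> lost in each exponent,
  are paid for by the strictness of the hypothesis on k, m, n.

  No limit function is extracted. Each compactness step becomes an inequality on a disc whose radius
  depends only on the constants, and Liouville's theorem becomes Cauchy's estimate for Q' on a large
  disc. That Q is small at one point comes from |g'(0)| \<ge> 1, which forces |g| to be large
  somewhere. The exponents are rational so that an N-th power makes Q a quotient of holomorphic
  functions.\<close>

lemma Cauchy_deriv_bound_ball:
  assumes "f holomorphic_on ball z r" "0 < s" "s < r" "\<And>w. w \<in> ball z r \<Longrightarrow> cmod (f w) \<le> B"
  shows "cmod ((deriv ^^ j) f z) \<le> fact j * B / s ^ j"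
proof (rule Cauchy_inequality)
  show "f holomorphic_on ball z s"
    using assms by (auto intro: holomorphic_on_subset)
  show "continuous_on (cball z s) f"
    using assms by (intro holomorphic_on_imp_continuous_on holomorphic_on_subset[OF assms(1)]) auto
  show "cmod (f x) \<le> B" if "cmod (z - x) = s" for x
    using assms that by (auto simp: dist_norm)
qed fact

text \<open>The Schwarz lemma for \<open>G\<close>, built from the Cayley transform of the right
  half-plane that sends \<open>F z\<close> to 0. With t = |w - z| / r it gives |F w - F z| \<le> t
  (|F w - F z| + 2 Re (F z)); since t \<le> 1/2 the first term is absorbed, which doubles the
  constant to 4.\<close>

lemma Harnack_ball:
  assumes F: "F holomorphic_on ball z r" and pos: "\<And>w. w \<in> ball z r \<Longrightarrow> Re (F w) > 0"
    and w: "cmod (w - z) \<le> r / 2" and r: "0 < r"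
  shows "cmod (F w - F z) \<le> 4 * (cmod (w - z) / r) * Re (F z)"
proof -
  define b where "b = F z"
  have b: "Re b > 0" using pos r by (auto simp: b_def)
  define G where "G = (\<lambda>\<zeta>. (F (z + of_real r * \<zeta>) - b) / (F (z + of_real r * \<zeta>) + cnj b))"
  have mem: "z + of_real r * \<zeta> \<in> ball z r" if "\<zeta> \<in> ball 0 1" for \<zeta>
    using that r by (auto simp: dist_norm norm_mult)
  have nz: "F (z + of_real r * \<zeta>) + cnj b \<noteq> 0" if "\<zeta> \<in> ball 0 1" for \<zeta>
    using pos[OF mem[OF that]] b by (auto simp: complex_eq_iff)
  have 1: "(\<lambda>\<zeta>. F (z + of_real r * \<zeta>)) holomorphic_on ball 0 1"
    by (rule holomorphic_on_compose_gen[OF _ F, unfolded o_def])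
       (use mem in \<open>auto intro!: holomorphic_intros\<close>)
  have holG: "G holomorphic_on ball 0 1"
    unfolding G_def using nz by (auto intro!: holomorphic_intros 1)
  have less: "cmod (A - b) < cmod (A + cnj b)" if "Re A > 0" for A
  proof -
    have "(Re A - Re b)\<^sup>2 < (Re A + Re b)\<^sup>2"
      using that b by (simp add: power2_eq_square algebra_simps)
    then show ?thesis unfolding cmod_def by simp
  qed
  define \<zeta> where "\<zeta> = (w - z) / of_real r"
  have \<zeta>: "cmod \<zeta> = cmod (w - z) / r" using r by (simp add: \<zeta>_def norm_divide)
  have s: "cmod \<zeta> \<le> 1/2" using w r by (simp add: \<zeta> field_simps)
  have "cmod (G \<zeta>) \<le> cmod \<zeta>"
  proof (rule Schwarz_Lemma(1)[OF holG])
    show "G 0 = 0" by (simp add: G_def b_def)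
    show "cmod (G \<zeta>) < 1" if "cmod \<zeta> < 1" for \<zeta>
      using less[OF pos[OF mem[of \<zeta>]]] nz[of \<zeta>] that by (simp add: G_def norm_divide)
    show "cmod \<zeta> < 1" using s by simp
  qed
  moreover have "z + of_real r * \<zeta> = w" using r by (simp add: \<zeta>_def)
  moreover have "w \<in> ball z r" using w r by (auto simp: dist_norm norm_minus_commute)
  then have p: "Re (F w) > 0" using pos by auto
  ultimately have *: "cmod (F w - b) \<le> cmod \<zeta> * cmod (F w + cnj b)"
    using less[OF p] by (simp add: G_def norm_divide divide_le_eq mult.commute split: if_splits)
  have "cmod (F w + cnj b) \<le> cmod (F w - b) + cmod (b + cnj b)"
    using norm_triangle_ineq[of "F w - b" "b + cnj b"] by simp
  also have "cmod (b + cnj b) = 2 * Re b"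
    using b by (simp add: complex_add_cnj)
  finally have "cmod (F w - b) \<le> cmod \<zeta> * (cmod (F w - b) + 2 * Re b)"
    using * by (meson mult_left_mono norm_ge_zero order_trans)
  moreover have "cmod \<zeta> * cmod (F w - b) \<le> 1/2 * cmod (F w - b)"
    by (rule mult_right_mono[OF s]) simp
  ultimately have "cmod (F w - b) \<le> 4 * cmod \<zeta> * Re b"
    by (simp add: algebra_simps)
  then show ?thesis by (simp add: \<zeta> b_def)
qed

text \<open>\<open>Harnack_ball\<close> keeps \<open>F\<close> within 2 Re (F z) of its central
  value on the ball of half the radius, where Cauchy's estimate applies.\<close>

lemma deriv_bound_of_Re_pos:
  assumes F: "F holomorphic_on ball z r" and pos: "\<And>w. w \<in> ball z r \<Longrightarrow> Re (F w) > 0" and r: "0 < r"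
  shows "cmod (deriv F z) \<le> 4 * Re (F z) / r"
proof -
  have b: "Re (F z) > 0" using pos r by auto
  have "cmod ((deriv ^^ 1) F z) \<le> fact 1 * (2 * Re (F z)) / (r / 2) ^ 1"
  proof (rule Cauchy_higher_deriv_bound)
    show "F holomorphic_on ball z (r / 2)"
      using F r by (auto intro: holomorphic_on_subset)
    show "continuous_on (cball z (r / 2)) F"
      using r by (intro holomorphic_on_imp_continuous_on holomorphic_on_subset[OF F]) auto
    show "F w \<in> ball (F z) (2 * Re (F z))" if "w \<in> ball z (r / 2)" for w
    proof -
      have w: "cmod (w - z) < r / 2" using that by (simp add: dist_norm norm_minus_commute)
      have "cmod (F w - F z) \<le> 4 * (cmod (w - z) / r) * Re (F z)"
        using Harnack_ball[OF F pos _ r] w by auto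
      also have "\<dots> < 2 * Re (F z)" using w r b by (simp add: field_simps)
      finally show ?thesis by (simp add: dist_norm norm_minus_commute)
    qed
  qed (use r in auto)
  then show ?thesis by simp
qed

subsection \<open>Zeros of prescribed order\<close>

text \<open>The order is at least \<open>m\<close>: \<open>u\<close> may vanish at \<open>z\<close>,
  even identically. Functions that are zero near \<open>z\<close> are thus included without a case
  distinction.\<close>

definition vanishes_order :: "nat \<Rightarrow> (complex \<Rightarrow> complex) \<Rightarrow> complex \<Rightarrow> bool" where
  "vanishes_order m f z \<longleftrightarrow>
     (\<exists>u. u analytic_on {z} \<and> (\<forall>\<^sub>F w in nhds z. f w = (w - z) ^ m * u w))"

lemma vanishes_order_factor:
  assumes f: "f holomorphic_on S" and S: "open S" "a \<in> S" and van: "vanishes_order m f a"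
  obtains u where "u holomorphic_on S" "\<And>w. w \<in> S \<Longrightarrow> f w = (w - a) ^ m * u w"
proof -
  obtain v where v: "v analytic_on {a}" and ev: "\<forall>\<^sub>F w in nhds a. f w = (w - a) ^ m * v w"
    using van by (auto simp: vanishes_order_def)
  obtain T where T: "open T" "a \<in> T" "v holomorphic_on T"
    using v by (auto simp: analytic_at)
  obtain T' where T': "open T'" "a \<in> T'" "\<And>w. w \<in> T' \<Longrightarrow> f w = (w - a) ^ m * v w"
    using ev by (auto simp: eventually_nhds)
  define U where "U = T \<inter> T' \<inter> S"
  have U: "open U" "a \<in> U" "U \<subseteq> S" using T T' S by (auto simp: U_def)
  define u where "u = (\<lambda>w. if w \<in> U then v w else f w / (w - a) ^ m)"
  have eq: "f w = (w - a) ^ m * u w" if "w \<in> S" for w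
    using that T'(3)[of w] U(2) by (auto simp: u_def U_def)
  have "u holomorphic_on U \<union> (S - {a})"
  proof (rule holomorphic_on_Un)
    show "u holomorphic_on U"
      by (rule holomorphic_transform[OF holomorphic_on_subset[OF T(3)]]) (auto simp: u_def U_def)
    have "(\<lambda>w. f w / (w - a) ^ m) holomorphic_on (S - {a})"
      by (intro holomorphic_intros holomorphic_on_subset[OF f]) auto
    then show "u holomorphic_on (S - {a})"
      by (rule holomorphic_transform) (use eq in \<open>auto simp: field_simps\<close>)
  qed (use U S in auto)
  moreover have "U \<union> (S - {a}) = S" using U by auto
  ultimately show ?thesis using that eq by auto
qed

text \<open>A Schwarz lemma for a zero of order \<open>m\<close>: the maximum principle is applied
  to the cofactor \<open>u\<close> on the circle of radius 3 \<delta> / 4, whose points are at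
  distance at least \<delta> / 2 from \<open>a\<close>.\<close>

lemma bounded_factor_bound:
  assumes f: "f holomorphic_on ball z \<delta>" and B: "\<And>w. w \<in> ball z \<delta> \<Longrightarrow> cmod (f w) \<le> K"
    and a: "cmod (a - z) \<le> \<delta> / 4" and van: "vanishes_order m f a" and \<delta>: "0 < \<delta>"
    and w: "cmod (w - z) \<le> \<delta> / 4"
  shows "cmod (f w) \<le> K * (2 / \<delta> * cmod (w - a)) ^ m"
proof -
  have aS: "a \<in> ball z \<delta>" using a \<delta> by (auto simp: dist_norm norm_minus_commute)
  obtain u where u: "u holomorphic_on ball z \<delta>" "\<And>w. w \<in> ball z \<delta> \<Longrightarrow> f w = (w - a) ^ m * u w"
    using vanishes_order_factor[OF f open_ball aS van] by blast
  have "cmod (u w) \<le> K * (2 / \<delta>) ^ m"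
  proof (rule maximum_modulus_frontier[of u "cball z (3 * \<delta> / 4)"])
    show "u holomorphic_on interior (cball z (3 * \<delta> / 4))"
      using \<delta> by (auto intro!: holomorphic_on_subset[OF u(1)])
    show "continuous_on (closure (cball z (3 * \<delta> / 4))) u"
      using \<delta> by (auto intro!: holomorphic_on_imp_continuous_on holomorphic_on_subset[OF u(1)])
    show "w \<in> cball z (3 * \<delta> / 4)" using w \<delta> by (auto simp: dist_norm norm_minus_commute)
    fix x assume "x \<in> frontier (cball z (3 * \<delta> / 4))"
    then have x: "cmod (x - z) = 3 * \<delta> / 4" by (simp add: dist_norm norm_minus_commute)
    then have xS: "x \<in> ball z \<delta>" using \<delta> by (simp add: dist_norm norm_minus_commute)
    have "cmod (x - z) \<le> cmod (x - a) + cmod (a - z)" using norm_triangle_ineq[of "x - a" "a - z"] by simp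
    then have "\<delta> / 2 \<le> cmod (x - a)" using x a by simp
    then have "(\<delta> / 2) ^ m \<le> cmod (x - a) ^ m" using \<delta> by (intro power_mono) auto
    then have "(\<delta> / 2) ^ m * cmod (u x) \<le> cmod (x - a) ^ m * cmod (u x)" by (rule mult_right_mono) simp
    also have "\<dots> \<le> K" using B[OF xS] u(2)[OF xS] by (simp add: norm_mult norm_power)
    finally show "cmod (u x) \<le> K * (2 / \<delta>) ^ m" using \<delta> by (simp add: field_simps)
  qed auto
  then have "cmod (w - a) ^ m * cmod (u w) \<le> cmod (w - a) ^ m * (K * (2 / \<delta>) ^ m)"
    by (rule mult_left_mono) simp
  moreover have "f w = (w - a) ^ m * u w"
    using u(2)[of w] w \<delta> by (auto simp: dist_norm norm_minus_commute)
  ultimately show ?thesis by (simp add: norm_mult norm_power power_mult_distrib power_divide mult_ac)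
qed

lemma powr_root_power:
  fixes x :: real assumes "0 \<le> x" "0 < m" shows "(x powr (1 / real m)) ^ j = (if x = 0 \<and> j = 0 then 1 else x powr (real j / real m))"
  using assms by (cases "x = 0") (auto simp: powr_realpow[symmetric] powr_powr)

text \<open>
  With \<open>e = \<bar>f z\<bar> / K\<close> and \<open>s\<close> comparable to \<open>\<delta> e powr (1 / m)\<close>: if \<open>f\<close> has a zero within distance
  \<open>s\<close> of \<open>z\<close>, factor it out; otherwise \<open>ln f\<close> exists on the disc of radius \<open>s\<close> and Harnack's
  inequality applies.  The loss of \<open>\<eta>\<close> in the exponent comes from the second case only.
\<close>
lemma bound_near_of_zero_order:
  assumes m: "0 < m" and \<eta>: "0 < \<eta>" "\<eta> \<le> 1" and \<delta>: "0 < \<delta>"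
    and f: "f holomorphic_on ball z \<delta>" and B: "\<And>w. w \<in> ball z \<delta> \<Longrightarrow> cmod (f w) < K"
    and van: "\<And>w. w \<in> ball z \<delta> \<Longrightarrow> f w = 0 \<Longrightarrow> vanishes_order m f w"
    and nz: "f z \<noteq> 0"
    and w: "cmod (w - z) \<le> \<eta> / 4 * (\<delta> / 4 * (cmod (f z) / K) powr (1 / m))"
  shows "cmod (f w) \<le> K * (cmod (f z) / K) powr (1 - \<eta>)"
proof -
  define e where "e = cmod (f z) / K"
  have K: "cmod (f z) < K" "K > 0" using B[of z] \<delta> norm_ge_zero[of "f z"] by auto (smt (verit) norm_ge_zero)
  have e: "0 < e" "e < 1" using K nz by (auto simp: e_def)
  define s where "s = \<delta> / 4 * e powr (1 / m)"
  have s: "0 < s" "s \<le> \<delta> / 4" using \<delta> e by (auto simp: s_def mult_le_cancel_left1 powr_le1)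
  have ws: "cmod (w - z) \<le> \<eta> / 4 * s" using w by (simp add: s_def e_def)
  also have "\<eta> / 4 * s \<le> s" using \<eta> s by (simp add: mult_le_cancel_right1)
  finally have ws': "cmod (w - z) \<le> s" .
  have e1: "e \<le> e powr (1 - \<eta>)" using powr_mono'[of "1 - \<eta>" 1 e] e \<eta> by simp
  show ?thesis
  proof (cases "\<exists>a\<in>ball z s. f a = 0")
    case True
    then obtain a where a: "a \<in> ball z s" "f a = 0" by blast
    have az: "cmod (a - z) < s" using a by (simp add: dist_norm norm_minus_commute)
    have "cmod (f w) \<le> K * (2 / \<delta> * cmod (w - a)) ^ m"
    proof (rule bounded_factor_bound[OF f])
      show "vanishes_order m f a" using a s by (intro van) auto
    qed (use B az s ws' \<delta> in \<open>auto simp: less_imp_le\<close>)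
    also have "\<dots> \<le> K * (2 / \<delta> * (2 * s)) ^ m"
    proof -
      have "cmod (w - a) \<le> cmod (w - z) + cmod (a - z)" using norm_triangle_ineq4[of "w - z" "a - z"] by simp
      then have "cmod (w - a) \<le> 2 * s" using az ws' by simp
      then show ?thesis using \<delta> K by (intro mult_left_mono power_mono) (auto simp: divide_right_mono)
    qed
    also have "2 / \<delta> * (2 * s) = e powr (1 / m)" using \<delta> by (simp add: s_def)
    also have "(e powr (1 / m)) ^ m = e" using e m by (simp add: powr_root_power)
    also have "K * e \<le> K * e powr (1 - \<eta>)" using e1 K by simp
    finally show ?thesis by (simp add: e_def)
  next
    case False
    have sub: "ball z s \<subseteq> ball z \<delta>" using s \<delta> by auto
    obtain G where G: "G holomorphic_on ball z s" "\<And>x. x \<in> ball z s \<Longrightarrow> exp (G x) = f x / K"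
    proof (rule holomorphic_logarithm_exists[of "ball z s" "\<lambda>x. f x / K" z])
      show "(\<lambda>x. f x / complex_of_real K) holomorphic_on ball z s"
        using K by (intro holomorphic_intros holomorphic_on_subset[OF f sub]) auto
    qed (use False K s in auto)
    have norm: "exp (Re (G x)) = cmod (f x) / K" if "x \<in> ball z s" for x
      using arg_cong[OF G(2)[OF that], of cmod] K by (simp add: norm_divide)
    have neg: "Re (- G x) > 0" if "x \<in> ball z s" for x
    proof -
      have "exp (Re (G x)) < 1" using norm[OF that] B[of x] sub that K by auto
      then show ?thesis by simp
    qed
    have zs: "z \<in> ball z s" using s by simp
    \<comment> \<open>The factor \<open>\<eta> / 4\<close> in the hypothesis on \<open>w\<close> is
      there to cancel the 4 of \<open>Harnack_ball\<close>.\<close>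
    have le: "4 * (cmod (w - z) / s) \<le> \<eta>" using ws s by (simp add: field_simps)
    have w2: "cmod (w - z) \<le> s / 2"
    proof -
      have "\<eta> / 4 * s \<le> 1/2 * s" using \<eta> s by (intro mult_right_mono) auto
      then show ?thesis using ws by simp
    qed
    have "cmod (- G w - (- G z)) \<le> 4 * (cmod (w - z) / s) * Re (- G z)"
      using neg w2 s by (intro Harnack_ball holomorphic_intros G(1)) auto
    also have "\<dots> \<le> \<eta> * Re (- G z)"
      using le neg[OF zs] by (intro mult_right_mono) auto
    finally have "Re (G w) - Re (G z) \<le> \<eta> * Re (- G z)"
      using abs_Re_le_cmod[of "- G w - (- G z)"] by simp
    then have "Re (G w) \<le> (1 - \<eta>) * Re (G z)" by (simp add: algebra_simps)
    then have "exp (Re (G w)) \<le> exp ((1 - \<eta>) * Re (G z))" by simp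
    also have "\<dots> = e powr (1 - \<eta>)"
      using norm[OF zs] e by (simp add: powr_def e_def flip: norm[OF zs])
    finally have "exp (Re (G w)) \<le> e powr (1 - \<eta>)" .
    moreover have "w \<in> ball z s" using w2 s by (auto simp: dist_norm norm_minus_commute)
    ultimately have "cmod (f w) / K \<le> e powr (1 - \<eta>)" using norm by simp
    then show ?thesis using K by (simp add: e_def field_simps)
  qed
qed

lemma deriv_zero_of_vanishes_order:
  assumes van: "vanishes_order m f z" and j: "j < m"
  shows "(deriv ^^ j) f z = 0"
proof -
  obtain v where v: "v analytic_on {z}" and ev: "\<forall>\<^sub>F w in nhds z. f w = (w - z) ^ m * v w"
    using van by (auto simp: vanishes_order_def)
  obtain e where e: "0 < e" "v holomorphic_on ball z e"
    using v by (auto simp: analytic_on_def)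
  define g where "g = (\<lambda>w. (w - z) ^ m * v w)"
  have g: "g holomorphic_on ball z e" unfolding g_def by (intro holomorphic_intros e)
  have "(deriv ^^ j) f z = (deriv ^^ j) g z"
    by (rule higher_deriv_cong_ev) (use ev in \<open>auto simp: g_def\<close>)
  also have "\<dots> = (\<Sum>i = 0..j. of_nat (j choose i) * (deriv ^^ i) (\<lambda>w. (w - z) ^ m) z * (deriv ^^ (j - i)) v z)"
    unfolding g_def by (rule higher_deriv_mult[of _ "ball z e"]) (use e in \<open>auto intro!: holomorphic_intros\<close>)
  also have "\<dots> = 0"
    using j by (intro sum.neutral) (auto simp: higher_deriv_power)
  finally show ?thesis .
qed

text \<open>Cauchy's inequality on the disc provided by \<open>bound_near_of_zero_order\<close>. Its
  radius shrinks like (|f z| / K) powr (1 / m), so every derivative costs 1 / m in the exponent. The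
  model is f w = (w - a)^m, whose j-th derivative has size |f| powr (1 - j / m) exactly. The
  constant depends on j, m, \<eta>, \<delta> only, which makes the later bounds uniform in
  \<open>f\<close>.\<close>

lemma deriv_bound_of_zero_order:
  assumes m: "j < m" and \<eta>: "0 < \<eta>" "\<eta> \<le> 1" and \<delta>: "0 < \<delta>"
  obtains C where "C > 0"
    "\<And>f z K. f holomorphic_on ball z \<delta> \<Longrightarrow> (\<And>w. w \<in> ball z \<delta> \<Longrightarrow> cmod (f w) < K) \<Longrightarrow>
       (\<And>w. w \<in> ball z \<delta> \<Longrightarrow> f w = 0 \<Longrightarrow> vanishes_order m f w) \<Longrightarrow>
       cmod ((deriv ^^ j) f z) \<le> C * K * (cmod (f z) / K) powr (1 - real j / real m - \<eta>)"
proof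
  \<comment> \<open>Half of the radius allowed in \<open>bound_near_of_zero_order\<close>, without
    its factor \<open>e powr (1 / m)\<close>.\<close>
  define q where "q = \<eta> * \<delta> / 32"
  have q: "q > 0" using \<eta> \<delta> by (simp add: q_def)
  show "fact j / q ^ j > 0" using q by simp
  fix f z K
  assume f: "f holomorphic_on ball z \<delta>" and B: "\<And>w. w \<in> ball z \<delta> \<Longrightarrow> cmod (f w) < K"
    and van: "\<And>w. w \<in> ball z \<delta> \<Longrightarrow> f w = 0 \<Longrightarrow> vanishes_order m f w"
  have K: "cmod (f z) < K" using B[of z] \<delta> by auto
  then have K0: "K > 0" using norm_ge_zero[of "f z"] by linarith
  show "cmod ((deriv ^^ j) f z) \<le> fact j / q ^ j * K * (cmod (f z) / K) powr (1 - real j / real m - \<eta>)"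
  proof (cases "f z = 0")
    \<comment> \<open>Since \<open>0 powr x = 0\<close>, the claim at a zero of \<open>f\<close> is
      that the derivative itself vanishes; this is where j < m enters.\<close>
    case True
    then have "(deriv ^^ j) f z = 0"
      using van[of z] \<delta> m by (intro deriv_zero_of_vanishes_order) auto
    then show ?thesis using q K0 by simp
  next
    case False
    define e where "e = cmod (f z) / K"
    have e: "0 < e" "e < 1" using K K0 False by (auto simp: e_def)
    define s where "s = \<eta> / 4 * (\<delta> / 4 * e powr (1 / m))"
    have s: "0 < s" using \<delta> e \<eta> by (auto simp: s_def)
    have sd: "s \<le> \<delta>"
    proof -
      have "e powr (1 / m) \<le> 1" using e by (auto simp: powr_le1)
      then have "\<eta> * e powr (1 / m) \<le> 1 * 1" using \<eta> by (intro mult_mono) auto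
      then have "\<delta> * (\<eta> * e powr (1 / m)) \<le> \<delta> * 1" using \<delta> by (intro mult_left_mono) auto
      then show ?thesis using \<delta> by (simp add: s_def mult_ac)
    qed
    have "cmod ((deriv ^^ j) f z) \<le> fact j * (K * e powr (1 - \<eta>)) / (s / 2) ^ j"
    proof (rule Cauchy_deriv_bound_ball)
      show "f holomorphic_on ball z s" using sd by (auto intro: holomorphic_on_subset[OF f])
      show "cmod (f w) \<le> K * e powr (1 - \<eta>)" if "w \<in> ball z s" for w
        unfolding e_def
        by (rule bound_near_of_zero_order[OF _ \<eta> \<delta> f B van False])
           (use that m in \<open>auto simp: s_def e_def dist_norm norm_minus_commute\<close>)
    qed (use s in auto)
    also have "s / 2 = q * e powr (1 / m)" by (simp add: s_def q_def)
    also have "\<dots> ^ j = q ^ j * e powr (j / m)"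
      using e m by (simp add: power_mult_distrib powr_root_power)
    also have "fact j * (K * e powr (1 - \<eta>)) / (q ^ j * e powr (j / m)) = fact j / q ^ j * K * (e powr (1 - \<eta>) / e powr (j / m))"
      by simp
    also have "e powr (1 - \<eta>) / e powr (j / m) = e powr (1 - j / m - \<eta>)"
      by (simp add: powr_diff[symmetric] algebra_simps)
    finally show ?thesis by (simp add: e_def)
  qed
qed

subsection \<open>Functions of controlled logarithmic growth\<close>

text \<open>Comparable to 1 + ln x for large x and to 1 for small x; the square makes
  \<open>loggrowth (cmod (f z))\<close> differentiable also at the zeros of
  \<open>f\<close>.\<close>

definition loggrowth :: "real \<Rightarrow> real" where
  "loggrowth x = 1 + ln (1 + x\<^sup>2)"

definition growth :: "real \<Rightarrow> real" where
  "growth x = (1 + x) * loggrowth x"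

lemma loggrowth_ge_1: "loggrowth x \<ge> 1"
  by (simp add: loggrowth_def)

lemma growth_ge: "0 \<le> x \<Longrightarrow> growth x \<ge> 1 + x"
  using mult_left_mono[OF loggrowth_ge_1[of x], of "1 + x"] by (simp add: growth_def)

text \<open>Changing the scale of the blow-up by a fixed factor multiplies the rescaled function by
  a constant; this bounds the cost.\<close>

lemma growth_scale:
  assumes "0 \<le> x" "1 \<le> c"
  shows "growth (c * x) \<le> c * (1 + 2 * ln c) * growth x"
proof -
  have "1 + c * x \<le> c * (1 + x)" using assms by (simp add: algebra_simps)
  moreover have "loggrowth (c * x) \<le> (1 + 2 * ln c) * loggrowth x"
  proof -
    have "1 + (c * x)\<^sup>2 \<le> c\<^sup>2 * (1 + x\<^sup>2)"
      using assms by (simp add: algebra_simps power_mult_distrib)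
    moreover have "0 < 1 + (c * x)\<^sup>2" by (simp add: add_pos_nonneg)
    ultimately have "ln (1 + (c * x)\<^sup>2) \<le> ln (c\<^sup>2 * (1 + x\<^sup>2))"
      by simp
    also have "\<dots> = 2 * ln c + ln (1 + x\<^sup>2)"
      using assms add_pos_nonneg[of 1 "x\<^sup>2"] by (subst ln_mult) (auto simp: ln_realpow)
    finally have "loggrowth (c * x) \<le> 2 * ln c + loggrowth x" by (simp add: loggrowth_def)
    also have "\<dots> \<le> 2 * ln c * loggrowth x + loggrowth x"
      using assms mult_left_mono[OF loggrowth_ge_1[of x], of "2 * ln c"] by simp
    finally show ?thesis by (simp add: algebra_simps)
  qed
  ultimately have "(1 + c * x) * loggrowth (c * x) \<le> (c * (1 + x)) * ((1 + 2 * ln c) * loggrowth x)"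
    using assms loggrowth_ge_1[of "c * x"] by (intro mult_mono) auto
  then show ?thesis by (simp add: growth_def mult_ac)
qed

text \<open>Along the segment, ln (loggrowth |f|) has derivative at most 2 |f| |f'| |w - z| / ((1 +
  |f|^2) loggrowth |f|). The growth condition cancels the logarithm and leaves 2 x (1 + x) / (1 +
  x^2) \<le> 4 times C |w - z|.\<close>

lemma loggrowth_Lipschitz:
  assumes f: "f holomorphic_on S" and S: "open S" "convex S"
    and le: "\<And>w. w \<in> S \<Longrightarrow> cmod (deriv f w) \<le> C * growth (cmod (f w))"
    and z: "z \<in> S" and w: "w \<in> S"
  shows "loggrowth (cmod (f w)) \<le> exp (4 * C * cmod (w - z)) * loggrowth (cmod (f z))"
proof -
  define p where "p = (\<lambda>t. z + of_real t * (w - z))"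
  define D where "D = (\<lambda>t. (w - z) * deriv f (p t))"
  define Y where "Y = (\<lambda>t. (Re (f (p t)))\<^sup>2 + (Im (f (p t)))\<^sup>2)"
  define Y' where "Y' = (\<lambda>t. 2 * Re (f (p t)) * Re (D t) + 2 * Im (f (p t)) * Im (D t))"
  define u where "u = (\<lambda>t. ln (1 + ln (1 + Y t)))"
  have Y: "Y t = (cmod (f (p t)))\<^sup>2" for t by (simp add: Y_def cmod_power2)
  have Y0: "0 \<le> Y t" for t by (simp add: Y)
  then have Y1: "0 < 1 + Y t" "0 \<le> ln (1 + Y t)" for t by (auto simp: add_pos_nonneg)
  have pS: "p t \<in> S" if "0 \<le> t" "t \<le> 1" for t
  proof -
    have "p t = (1 - t) *\<^sub>R z + t *\<^sub>R w" by (simp add: p_def scaleR_conv_of_real algebra_simps)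
    then show ?thesis using S(2) z w that by (simp add: convex_alt)
  qed
  have du: "(u has_real_derivative Y' t / ((1 + Y t) * (1 + ln (1 + Y t)))) (at t)"
    if t: "0 \<le> t" "t \<le> 1" for t
  proof -
    have 1: "(f has_field_derivative deriv f (p t)) (at (p t))"
      using f S(1) pS[OF t] by (rule holomorphic_derivI)
    have "(p has_vector_derivative (w - z)) (at t)"
      unfolding p_def by (auto intro!: derivative_eq_intros has_vector_derivative_real_field)
    then have 2: "((\<lambda>t. f (p t)) has_vector_derivative D t) (at t)"
      using field_vector_diff_chain_at[of p "w - z" t f "deriv f (p t)"] 1 by (simp add: o_def D_def)
    have sq: "((\<lambda>t. (a t)\<^sup>2 + (b t)\<^sup>2) has_real_derivative 2 * a t * a' + 2 * b t * b') (at t)"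
      if "(a has_real_derivative a') (at t)" "(b has_real_derivative b') (at t)" for a b a' b'
      using that by (auto intro!: derivative_eq_intros)
    have "(Y has_real_derivative Y' t) (at t)"
      unfolding Y_def Y'_def
      using sq[OF has_field_derivative_Re[OF 2] has_field_derivative_Im[OF 2]] .
    then show ?thesis
      unfolding u_def using Y1[of t] add_pos_nonneg[OF zero_less_one Y1(2)[of t]] by (auto intro!: derivative_eq_intros simp: field_simps)
  qed
  obtain t where t: "0 < t" "t < 1" and mvt: "u 1 - u 0 = (1 - 0) * (Y' t / ((1 + Y t) * (1 + ln (1 + Y t))))"
    using MVT2[OF zero_less_one, of u "\<lambda>t. Y' t / ((1 + Y t) * (1 + ln (1 + Y t)))"] du by blast
  define x where "x = cmod (f (p t))"
  have x: "0 \<le> x" "Y t = x\<^sup>2" by (auto simp: x_def Y)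
  have "Y' t = 2 * Re (f (p t) * cnj (D t))" by (simp add: Y'_def)
  also have "\<dots> \<le> 2 * cmod (f (p t) * cnj (D t))" by (intro mult_left_mono complex_Re_le_cmod) simp
  also have "\<dots> = 2 * x * (cmod (w - z) * cmod (deriv f (p t)))"
    by (simp add: norm_mult x_def D_def del: complex_cnj_mult)
  also have "\<dots> \<le> 2 * x * (cmod (w - z) * (C * growth x))"
    using le[OF pS[of t]] t by (intro mult_left_mono) (auto simp: x_def)
  also have "\<dots> = C * cmod (w - z) * (2 * x * (1 + x)) * (1 + ln (1 + x\<^sup>2))"
    by (simp add: growth_def loggrowth_def)
  also have "\<dots> \<le> C * cmod (w - z) * (4 * (1 + x\<^sup>2)) * (1 + ln (1 + x\<^sup>2))"
  proof -
    have "0 \<le> (x - 1)\<^sup>2" by simp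
    then have "2 * x \<le> 1 + x\<^sup>2" by (simp add: power2_diff)
    moreover have "2 * x * (1 + x) = 2 * x + 2 * x\<^sup>2" by (simp add: power2_eq_square algebra_simps)
    moreover have "0 \<le> x\<^sup>2" by simp
    ultimately have "2 * x * (1 + x) \<le> 4 * (1 + x\<^sup>2)" by argo
    moreover have "0 \<le> C"
    proof -
      have "0 < growth x" using growth_ge[OF x(1)] x by linarith
      moreover have "0 \<le> C * growth x" using le[OF pS[of t]] t norm_ge_zero unfolding x_def by (meson less_imp_le order_trans)
      ultimately show ?thesis by (simp add: zero_le_mult_iff)
    qed
    ultimately show ?thesis by (intro mult_right_mono mult_left_mono) auto
  qed
  finally have "Y' t \<le> 4 * C * cmod (w - z) * ((1 + Y t) * (1 + ln (1 + Y t)))"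
    by (simp add: x algebra_simps)
  then have "Y' t / ((1 + Y t) * (1 + ln (1 + Y t))) \<le> 4 * C * cmod (w - z)"
    using Y1[of t] add_pos_nonneg[OF zero_less_one Y1(2)[of t]]
    by (intro mult_imp_div_pos_le) (auto intro!: mult_pos_pos)
  then have "u 1 \<le> 4 * C * cmod (w - z) + u 0" using mvt by simp
  then have "exp (u 1) \<le> exp (4 * C * cmod (w - z)) * exp (u 0)" by (simp flip: exp_add)
  moreover have "exp (u t) = loggrowth (cmod (f (p t)))" for t
    using Y1[of t] by (simp add: u_def loggrowth_def Y add_pos_nonneg)
  ultimately show ?thesis by (simp add: p_def)
qed

lemma loggrowth_le_imp_le:
  assumes "loggrowth x \<le> c" shows "x \<le> exp c"
proof -
  have "ln (1 + x\<^sup>2) \<le> c" using assms by (simp add: loggrowth_def)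
  moreover have "0 < 1 + x\<^sup>2" by (simp add: add_pos_nonneg)
  ultimately have *: "1 + x\<^sup>2 \<le> exp c" by (metis exp_le_cancel_iff exp_ln)
  have "0 \<le> (x - 1)\<^sup>2" by simp
  then have "2 * x \<le> 1 + x\<^sup>2" by (simp add: power2_diff)
  moreover have "0 \<le> x\<^sup>2" by simp
  ultimately have "x \<le> 1 + x\<^sup>2" by linarith
  with * show ?thesis by simp
qed

lemma loggrowth_le_mult_imp_less:
  assumes le: "loggrowth x \<le> (1 + \<eta>) * loggrowth y" and y: "0 \<le> y" and \<eta>: "0 < \<eta>" "\<eta> \<le> 1"
  shows "x < 3 * (1 + y) powr (1 + \<eta>)"
proof -
  have pos: "0 < 1 + t\<^sup>2" for t :: real by (simp add: add_pos_nonneg)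
  have "ln (1 + x\<^sup>2) \<le> \<eta> + (1 + \<eta>) * ln (1 + y\<^sup>2)"
    using le by (simp add: loggrowth_def algebra_simps)
  then have "1 + x\<^sup>2 \<le> exp (\<eta> + (1 + \<eta>) * ln (1 + y\<^sup>2))"
    using pos by (metis exp_le_cancel_iff exp_ln)
  also have "\<dots> = exp \<eta> * (1 + y\<^sup>2) powr (1 + \<eta>)"
    using pos[of y] by (simp add: exp_add powr_def)
  also have "\<dots> \<le> 3 * ((1 + y)\<^sup>2) powr (1 + \<eta>)"
  proof (intro mult_mono powr_mono2)
    show "exp \<eta> \<le> 3" using \<eta> exp_le by (meson exp_le_cancel_iff order_trans)
    show "1 + y\<^sup>2 \<le> (1 + y)\<^sup>2" using y by (simp add: power2_sum)
  qed (use \<eta> pos[of y] in auto)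
  also have "((1 + y)\<^sup>2) powr (1 + \<eta>) = ((1 + y) powr (1 + \<eta>))\<^sup>2"
    using y by (simp add: power2_eq_square powr_mult)
  also have "3 * \<dots> \<le> (3 * (1 + y) powr (1 + \<eta>))\<^sup>2" by (simp add: power_mult_distrib)
  finally have "x\<^sup>2 < (3 * (1 + y) powr (1 + \<eta>))\<^sup>2" by simp
  then show ?thesis by (rule power2_less_imp_less) simp
qed

text \<open>The radius is chosen with exp (4 C \<delta>) \<le> 1 + \<eta>. Then
  \<open>loggrowth\<close> gains at most a factor 1 + \<eta>, which becomes a power after
  exponentiation. The result supplies the bound \<open>K\<close> that
  \<open>deriv_bound_of_zero_order\<close> requires.\<close>

lemma local_growth:
  assumes C: "0 < C" and \<eta>: "0 < \<eta>" "\<eta> \<le> 1"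
  obtains \<delta> where "0 < \<delta>" "\<delta> \<le> 1"
    "\<And>f z w. f holomorphic_on ball z \<delta> \<Longrightarrow>
       (\<And>w. w \<in> ball z \<delta> \<Longrightarrow> cmod (deriv f w) \<le> C * growth (cmod (f w))) \<Longrightarrow> w \<in> ball z \<delta> \<Longrightarrow>
       cmod (f w) < 3 * (1 + cmod (f z)) powr (1 + \<eta>)"
proof
  define \<delta> where "\<delta> = min 1 (ln (1 + \<eta>) / (4 * C))"
  show \<delta>: "0 < \<delta>" "\<delta> \<le> 1" using C \<eta> by (auto simp: \<delta>_def)
  fix f z w
  assume f: "f holomorphic_on ball z \<delta>" and le: "\<And>w. w \<in> ball z \<delta> \<Longrightarrow> cmod (deriv f w) \<le> C * growth (cmod (f w))"
    and w: "w \<in> ball z \<delta>"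
  have "loggrowth (cmod (f w)) \<le> exp (4 * C * cmod (w - z)) * loggrowth (cmod (f z))"
    using loggrowth_Lipschitz[OF f _ _ le _ w] \<delta> by simp
  also have "\<dots> \<le> (1 + \<eta>) * loggrowth (cmod (f z))"
  proof (rule mult_right_mono)
    have "cmod (w - z) \<le> ln (1 + \<eta>) / (4 * C)"
      using w by (simp add: dist_norm norm_minus_commute \<delta>_def)
    then have "4 * C * cmod (w - z) \<le> ln (1 + \<eta>)" using C by (simp add: field_simps)
    then have "exp (4 * C * cmod (w - z)) \<le> exp (ln (1 + \<eta>))" by (simp only: exp_le_cancel_iff)
    then show "exp (4 * C * cmod (w - z)) \<le> 1 + \<eta>" using \<eta> by simp
  qed (use loggrowth_ge_1[of "cmod (f z)"] in linarith)
  finally show "cmod (f w) < 3 * (1 + cmod (f z)) powr (1 + \<eta>)"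
    using \<eta> by (intro loggrowth_le_mult_imp_less) auto
qed

subsection \<open>The pointwise bound for the auxiliary quotient\<close>

definition admissible :: "nat \<Rightarrow> nat \<Rightarrow> nat \<Rightarrow> complex set \<Rightarrow> (complex \<Rightarrow> complex) \<Rightarrow> bool" where
  "admissible k m n S f \<longleftrightarrow> f holomorphic_on S \<and>
     (\<forall>z\<in>S. f z = 0 \<longrightarrow> vanishes_order m f z) \<and>
     (\<forall>z\<in>S. (deriv ^^ k) f z = 1 \<longrightarrow> vanishes_order n (\<lambda>w. (deriv ^^ k) f w - 1) z)"

lemma admissible_subset: "admissible k m n S f \<Longrightarrow> T \<subseteq> S \<Longrightarrow> admissible k m n T f"
  by (auto simp: admissible_def intro: holomorphic_on_subset)

text \<open>After clearing denominators the hypothesis is a strict inequality between integers, so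
  its gap \<theta> is at least 1 / (m n) = 5 \<eta>. Replacing \<alpha> + \<beta> - 1 by \<kappa>,
  which allows for the exponent 1 + \<eta> of \<open>local_growth\<close>, costs at most 4 \<eta> in
  all. \<open>N\<close> is a common denominator of \<alpha> and \<beta>.\<close>

lemma exponents_exist:
  assumes pos: "k > 0" "m > 0" "n > 0" and less: "(real k + 1) / real m + 1 / real n < 1"
  obtains \<eta> \<alpha> \<beta> \<kappa> :: real and N a b :: nat where
    "0 < \<eta>" "\<eta> \<le> 1" "\<alpha> = 1 - (real k + 1) / real m - \<eta>" "\<beta> = 1 - 1 / real n - \<eta>"
    "0 < \<alpha>" "0 < \<beta>" "0 < \<kappa>" "\<kappa> = \<alpha> - (1 + \<eta>) * (1 - \<beta>)"
    "0 < N" "real a = N * \<alpha>" "real b = N * \<beta>"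
proof -
  define \<theta> where "\<theta> = 1 - (real k + 1) / real m - 1 / real n"
  define \<eta> :: real where "\<eta> = 1 / (5 * m * n)"
  define \<alpha> where "\<alpha> = 1 - (real k + 1) / real m - \<eta>"
  define \<beta> where "\<beta> = 1 - 1 / real n - \<eta>"
  define N where "N = m * n * (5 * m * n)"
  have mn: "real m * real n > 0" using pos by simp
  have "(real k + 1) * n + m < real m * real n"
  proof -
    have "((real k + 1) / real m + 1 / real n) * (real m * real n) < 1 * (real m * real n)"
      using less mn by (intro mult_strict_right_mono)
    moreover have "((real k + 1) / real m + 1 / real n) * (real m * real n) = (real k + 1) * n + m"
      using pos by (simp add: field_simps)
    ultimately show ?thesis by simp
  qed
  then have "real ((k + 1) * n + m) < real (m * n)" by (simp add: algebra_simps)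
  then have "(k + 1) * n + m + 1 \<le> m * n" by linarith
  then have "real ((k + 1) * n + m + 1) \<le> real (m * n)" by linarith
  then have "1 / (real m * real n) \<le> \<theta>"
    using pos by (simp add: \<theta>_def field_simps)
  then have \<theta>: "5 * \<eta> \<le> \<theta>" by (simp add: \<eta>_def field_simps)
  have \<eta>: "0 < \<eta>" using pos by (simp add: \<eta>_def)
  have n1: "0 < 1 / real n" "1 / real n \<le> 1" and km: "0 < (real k + 1) / real m" using pos by auto
  have \<eta>1: "\<eta> \<le> 1" using \<theta> \<eta> n1 km unfolding \<theta>_def by linarith
  have \<alpha>: "0 < \<alpha>" using \<theta> \<eta> n1 unfolding \<alpha>_def \<theta>_def by linarith
  have \<beta>: "0 < \<beta>" using \<theta> \<eta> km unfolding \<beta>_def \<theta>_def by linarith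
  have "\<eta> * (1 / real n) \<le> \<eta>" "\<eta> * \<eta> \<le> \<eta>"
    using \<eta> \<eta>1 n1 mult_left_le[of "1 / real n" \<eta>] mult_left_le[of \<eta> \<eta>] by auto
  moreover have "\<alpha> - (1 + \<eta>) * (1 - \<beta>) = \<theta> - 2 * \<eta> - \<eta> * (1 / real n) - \<eta> * \<eta>"
    by (simp add: \<alpha>_def \<beta>_def \<theta>_def algebra_simps add_divide_distrib)
  ultimately have \<kappa>: "0 < \<alpha> - (1 + \<eta>) * (1 - \<beta>)" using \<theta> \<eta> by linarith
  have N\<alpha>: "N * \<alpha> = real (m * n * (5 * m * n)) - real ((k + 1) * n * (5 * m * n) + m * n)"
    using pos by (simp add: N_def \<alpha>_def \<eta>_def field_simps)
  have N\<beta>: "N * \<beta> = real (m * n * (5 * m * n)) - real (m * (5 * m * n) + m * n)"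
    using pos by (simp add: N_def \<beta>_def \<eta>_def field_simps)
  have N: "0 < N" using pos by (simp add: N_def)
  have "0 < N * \<alpha>" "0 < N * \<beta>" using N \<alpha> \<beta> by auto
  then have "(k + 1) * n * (5 * m * n) + m * n \<le> m * n * (5 * m * n)"
    "m * (5 * m * n) + m * n \<le> m * n * (5 * m * n)"
    unfolding N\<alpha> N\<beta> by linarith+
  then show ?thesis
    using that[of \<eta> \<alpha> \<beta> "\<alpha> - (1 + \<eta>) * (1 - \<beta>)" N
        "m * n * (5 * m * n) - ((k + 1) * n * (5 * m * n) + m * n)"
        "m * n * (5 * m * n) - (m * (5 * m * n) + m * n)"]
      \<eta> \<eta>1 \<alpha> \<beta> \<kappa> N N\<alpha> N\<beta> \<alpha>_def \<beta>_def by (simp only: of_nat_diff)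
qed

lemma mult_powr_divide_le:
  fixes K :: real assumes "0 < K" "0 \<le> y"
  shows "K * (y / K) powr b = K powr (1 - b) * y powr b"
  using assms by (simp add: powr_divide powr_diff)

text \<open>The (k+1)-st derivative of \<open>g\<close> can be estimated in two ways: through the
  zeros of \<open>g\<close>, with exponent \<alpha>, or as the first derivative of the k-th
  derivative minus 1, through the zeros of the latter, with exponent \<beta>. The product bound
  holds because the two factors are never small together: where \<open>g\<close> is small, so is its
  k-th derivative, which is then far from 1.\<close>

lemma pointwise_bounds:
  fixes \<eta> \<alpha> \<beta> \<kappa> C :: real
  assumes \<eta>: "0 < \<eta>" "\<eta> \<le> 1"
    and \<alpha>: "\<alpha> = 1 - (real k + 1) / real m - \<eta>" "0 < \<alpha>" and \<beta>: "\<beta> = 1 - 1 / real n - \<eta>" "0 < \<beta>"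
    and \<kappa>: "\<kappa> = \<alpha> - (1 + \<eta>) * (1 - \<beta>)" "0 < \<kappa>" and km: "k + 1 < m" and n: "1 < n"
    and C: "0 < C"
  obtains \<delta> B where "0 < \<delta>" "\<delta> \<le> 1" "0 < B"
    "\<And>g z j. admissible k m n (ball z \<delta>) g \<Longrightarrow>
      (\<And>w. w \<in> ball z \<delta> \<Longrightarrow> cmod (deriv g w) \<le> C * growth (cmod (g w))) \<Longrightarrow> j \<le> k \<Longrightarrow> cmod (g z) \<le> 1 \<Longrightarrow>
      cmod ((deriv ^^ j) g z) \<le> B * cmod (g z) powr (1 - real k / real m - \<eta>)"
    "\<And>g z. admissible k m n (ball z \<delta>) g \<Longrightarrow>
      (\<And>w. w \<in> ball z \<delta> \<Longrightarrow> cmod (deriv g w) \<le> C * growth (cmod (g w))) \<Longrightarrow>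
      cmod ((deriv ^^ Suc k) g z) \<le>
        B * (1 + cmod (g z)) powr (- \<kappa>) * cmod (g z) powr \<alpha> * cmod ((deriv ^^ k) g z - 1) powr \<beta>"
proof -
  obtain \<delta> where \<delta>: "0 < \<delta>" "\<delta> \<le> 1" and
    gr: "\<And>f z w. f holomorphic_on ball z \<delta> \<Longrightarrow>
       (\<And>w. w \<in> ball z \<delta> \<Longrightarrow> cmod (deriv f w) \<le> C * growth (cmod (f w))) \<Longrightarrow> w \<in> ball z \<delta> \<Longrightarrow>
       cmod (f w) < 3 * (1 + cmod (f z)) powr (1 + \<eta>)"
    using local_growth[OF C \<eta>] by blast
  define \<tau> where "\<tau> = (\<lambda>j. 1 - real j / real m - \<eta>)"
  have "\<exists>A>0. \<forall>f z K. f holomorphic_on ball z \<delta> \<longrightarrow> (\<forall>w\<in>ball z \<delta>. cmod (f w) < K) \<longrightarrow>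
       (\<forall>w\<in>ball z \<delta>. f w = 0 \<longrightarrow> vanishes_order m f w) \<longrightarrow>
       cmod ((deriv ^^ j) f z) \<le> A * K * (cmod (f z) / K) powr \<tau> j" if j: "j \<le> Suc k" for j
  proof -
    have jm: "j < m" using j km by simp
    show ?thesis unfolding \<tau>_def by (rule deriv_bound_of_zero_order[OF jm \<eta> \<delta>(1)]) metis
  qed
  then have "\<forall>j. \<exists>A>0. j \<le> Suc k \<longrightarrow> (\<forall>f z K. f holomorphic_on ball z \<delta> \<longrightarrow> (\<forall>w\<in>ball z \<delta>. cmod (f w) < K) \<longrightarrow>
       (\<forall>w\<in>ball z \<delta>. f w = 0 \<longrightarrow> vanishes_order m f w) \<longrightarrow>
       cmod ((deriv ^^ j) f z) \<le> A * K * (cmod (f z) / K) powr \<tau> j)"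
    by (metis zero_less_one)
  then obtain A where A: "\<And>j. A j > (0::real)" and
    lowA: "\<And>j f z K. j \<le> Suc k \<Longrightarrow> f holomorphic_on ball z \<delta> \<Longrightarrow> \<forall>w\<in>ball z \<delta>. cmod (f w) < K \<Longrightarrow>
       \<forall>w\<in>ball z \<delta>. f w = 0 \<longrightarrow> vanishes_order m f w \<Longrightarrow>
       cmod ((deriv ^^ j) f z) \<le> A j * K * (cmod (f z) / K) powr \<tau> j"
    by metis
  obtain D where D: "D > 0" and
    lowD: "\<And>f z K. f holomorphic_on ball z (\<delta>/2) \<Longrightarrow> (\<And>w. w \<in> ball z (\<delta>/2) \<Longrightarrow> cmod (f w) < K) \<Longrightarrow>
       (\<And>w. w \<in> ball z (\<delta>/2) \<Longrightarrow> f w = 0 \<Longrightarrow> vanishes_order n f w) \<Longrightarrow>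
       cmod ((deriv ^^ 1) f z) \<le> D * K * (cmod (f z) / K) powr \<beta>"
    using deriv_bound_of_zero_order[OF n \<eta>, of "\<delta>/2"] \<delta> \<beta>(1) by (metis half_gt_zero of_nat_1)
  \<comment> \<open>Cauchy's estimate with radius \<delta> / 4 turns |g| < K on the ball of radius
    \<delta> into a bound for the k-th derivative on the ball of radius \<delta> / 2; the summand 1
    allows for subtracting 1 from it.\<close>
  define c where "c = fact k * (4 / \<delta>) ^ k + 1"
  have c: "1 \<le> c" using \<delta> by (simp add: c_def)
  define A' where "A' = (\<Sum>j\<le>Suc k. 12 * A j)"
  have A'_le: "12 * A j \<le> A'" if "j \<le> Suc k" for j
    unfolding A'_def using that A by (intro member_le_sum) (auto simp: less_imp_le)
  have A'0: "0 < A'" using A'_le[of 0] A[of 0] by simp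
  \<comment> \<open>With |g z| = x and y the distance of the k-th derivative from 1, the three
    summands serve the cases x < 1 and y \<ge> 1/2, x \<ge> 1, and x < 1 and y < 1/2.\<close>
  define B where "B = A' * 4 + 6 * c * D + 48 * c * D * A'"
  have B: "0 < B" "A' \<le> B" "A' * 4 \<le> B" "6 * c * D \<le> B" "48 * c * D * A' \<le> B"
    using A'0 c D by (auto simp: B_def add_pos_pos)
  have \<tau>\<alpha>: "\<tau> (Suc k) = \<alpha>" using \<alpha> by (simp add: \<tau>_def add.commute)
  have \<tau>_mono: "\<tau> i \<ge> \<tau> j" if "i \<le> j" for i j using that by (simp add: \<tau>_def divide_right_mono)
  have \<alpha>1: "\<alpha> < 1" and \<beta>1: "\<beta> < 1" 
  proof -
    have "0 \<le> (real k + 1) / real m" "0 \<le> 1 / real n" by auto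
    then show "\<alpha> < 1" "\<beta> < 1" using \<alpha> \<beta> \<eta> by linarith+
  qed
  have \<kappa>1: "\<kappa> \<le> 1" using \<kappa> \<alpha>1 \<eta> \<beta>1 mult_pos_pos[of "1 + \<eta>" "1 - \<beta>"] by linarith
  have small: "cmod ((deriv ^^ j) g z) \<le> A' * cmod (g z) powr \<tau> j"
    if adm: "admissible k m n (ball z \<delta>) g" and
      der: "\<And>w. w \<in> ball z \<delta> \<Longrightarrow> cmod (deriv g w) \<le> C * growth (cmod (g w))"
      and x1: "cmod (g z) \<le> 1" and j: "j \<le> Suc k" for g z j
  proof -
    have \<tau>0: "0 < \<tau> j" using \<tau>_mono[OF j] \<tau>\<alpha> \<alpha>(2) by simp
    define K where "K = 3 * (1 + cmod (g z)) powr (1 + \<eta>)"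
    have hol: "g holomorphic_on ball z \<delta>" and van: "\<forall>w\<in>ball z \<delta>. g w = 0 \<longrightarrow> vanishes_order m g w"
      using adm by (auto simp: admissible_def)
    have K1: "1 \<le> K" using \<eta> ge_one_powr_ge_zero[of "1 + cmod (g z)" "1 + \<eta>"] by (simp add: K_def)
    have "(1 + cmod (g z)) powr (1 + \<eta>) \<le> 2 powr 2"
      using x1 \<eta> by (intro powr_mono_both) auto
    then have K2: "K \<le> 12" by (simp add: K_def)
    have "cmod ((deriv ^^ j) g z) \<le> A j * K * (cmod (g z) / K) powr \<tau> j"
      by (rule lowA[OF j hol _ van]) (use gr[OF hol der] in \<open>auto simp: K_def\<close>)
    also have "\<dots> \<le> A j * 12 * cmod (g z) powr \<tau> j"
    proof -
      have "cmod (g z) / K \<le> cmod (g z)" using K1 by (simp add: divide_le_eq mult_le_cancel_left1)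
      then show ?thesis using K1 K2 A[of j] \<tau>0 by (intro mult_mono powr_mono2) auto
    qed
    also have "\<dots> \<le> A' * cmod (g z) powr \<tau> j"
      using A'_le[OF j] by (intro mult_right_mono) auto
    finally show ?thesis .
  qed
  show ?thesis
  proof (rule that[OF \<delta> B(1)])
    fix g z j
    assume adm: "admissible k m n (ball z \<delta>) g" and
      der: "\<And>w. w \<in> ball z \<delta> \<Longrightarrow> cmod (deriv g w) \<le> C * growth (cmod (g w))"
      and j: "j \<le> k" and x1: "cmod (g z) \<le> 1"
    have "cmod ((deriv ^^ j) g z) \<le> A' * cmod (g z) powr \<tau> j"
      using small[OF adm der x1, of j] j by simp
    also have "\<dots> \<le> B * cmod (g z) powr \<tau> k"
      using B A'0 x1 \<tau>_mono[OF j] by (intro mult_mono powr_mono') auto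
    finally show "cmod ((deriv ^^ j) g z) \<le> B * cmod (g z) powr (1 - real k / real m - \<eta>)"
      by (simp add: \<tau>_def)
  next
    fix g z
    assume adm: "admissible k m n (ball z \<delta>) g" and
      der: "\<And>w. w \<in> ball z \<delta> \<Longrightarrow> cmod (deriv g w) \<le> C * growth (cmod (g w))"
    define h where "h = (\<lambda>w. (deriv ^^ k) g w - 1)"
    define x where "x = cmod (g z)"
    define y where "y = cmod (h z)"
    define K where "K = 3 * (1 + x) powr (1 + \<eta>)"
    have x: "0 \<le> x" and y: "0 \<le> y" by (auto simp: x_def y_def)
    have hol: "g holomorphic_on ball z \<delta>" using adm by (auto simp: admissible_def)
    have K1: "1 < K" using \<eta> x ge_one_powr_ge_zero[of "1 + x" "1 + \<eta>"] by (simp add: K_def)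
    have gK: "cmod (g w) < K" if "w \<in> ball z \<delta>" for w
      using gr[OF hol der that] by (simp add: K_def x_def)
    have hder: "(deriv ^^ Suc k) g z = (deriv ^^ 1) h z"
      unfolding h_def using holomorphic_higher_deriv[OF hol open_ball, of k] \<delta>
      by (simp add: holomorphic_on_imp_differentiable_at[of _ "ball z \<delta>"])
    have cK: "0 < c * K" using c K1 by simp
    have "cmod ((deriv ^^ 1) h z) \<le> D * (c * K) * (y / (c * K)) powr \<beta>"
      unfolding y_def
    proof (rule lowD)
      have "(deriv ^^ k) g holomorphic_on ball z (\<delta>/2)"
        using holomorphic_higher_deriv[OF hol open_ball, of k] \<delta> by (auto intro: holomorphic_on_subset)
      then show "h holomorphic_on ball z (\<delta>/2)" unfolding h_def by (rule holomorphic_on_diff) auto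
      show "vanishes_order n h w" if "w \<in> ball z (\<delta>/2)" "h w = 0" for w
        using adm that \<delta> by (auto simp: admissible_def h_def)
      show "cmod (h w) < c * K" if w: "w \<in> ball z (\<delta>/2)" for w
      proof -
        have sub: "ball w (\<delta>/2) \<subseteq> ball z \<delta>"
        proof
          fix v assume "v \<in> ball w (\<delta>/2)"
          then show "v \<in> ball z \<delta>" using w dist_triangle[of z v w] by simp
        qed
        have "cmod ((deriv ^^ k) g w) \<le> fact k * K / (\<delta> / 4) ^ k"
          by (rule Cauchy_deriv_bound_ball[of _ _ "\<delta>/2"])
             (use sub \<delta> gK in \<open>auto intro: holomorphic_on_subset[OF hol] simp: less_imp_le subset_iff\<close>)
        also have "\<dots> = (c - 1) * K" by (simp add: c_def power_divide)
        finally have "cmod (h w) \<le> (c - 1) * K + 1"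
          unfolding h_def using norm_triangle_ineq4[of "(deriv ^^ k) g w" 1] by simp
        also have "\<dots> < c * K" using K1 by (simp add: algebra_simps)
        finally show ?thesis .
      qed
    qed
    also have "\<dots> = D * ((c * K) powr (1 - \<beta>) * y powr \<beta>)"
      using mult_powr_divide_le[OF cK y, of \<beta>] by (simp add: mult.assoc)
    finally have main: "cmod ((deriv ^^ Suc k) g z) \<le> D * (c * K) powr (1 - \<beta>) * y powr \<beta>"
      by (simp only: hder mult.assoc)
    have goal: "cmod ((deriv ^^ Suc k) g z) \<le> B * (1 + x) powr (- \<kappa>) * x powr \<alpha> * y powr \<beta>"
    proof (cases "1 \<le> x")
      case True
      \<comment> \<open>The zeros of \<open>h\<close> give the factor \<open>y powr \<beta>\<close>, and \<open>K powr (1 - \<beta>)\<close> is beaten by \<open>x powr \<alpha>\<close> since \<open>\<kappa> > 0\<close>.\<close>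
      have "(c * K) powr (1 - \<beta>) = (3 * c) powr (1 - \<beta>) * (1 + x) powr ((1 + \<eta>) * (1 - \<beta>))"
        using c x by (simp add: K_def powr_mult powr_powr mult_ac)
      also have "(1 + \<eta>) * (1 - \<beta>) = - \<kappa> + \<alpha>" using \<kappa> by simp
      also have "(3 * c) powr (1 - \<beta>) * (1 + x) powr (- \<kappa> + \<alpha>) \<le> (3 * c) * ((1 + x) powr (- \<kappa>) * (2 * x powr \<alpha>))"
      proof -
        have "(3 * c) powr (1 - \<beta>) \<le> (3 * c) powr 1" using c \<beta>(2) by (intro powr_mono) auto
        moreover have "(1 + x) powr \<alpha> \<le> 2 * x powr \<alpha>"
        proof -
          have "(1 + x) powr \<alpha> \<le> (2 * x) powr \<alpha>" using True \<alpha>(2) by (intro powr_mono2) auto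
          also have "\<dots> = 2 powr \<alpha> * x powr \<alpha>" using x by (simp add: powr_mult)
          also have "\<dots> \<le> 2 powr 1 * x powr \<alpha>" using \<alpha>1 by (intro mult_right_mono powr_mono) auto
          finally show ?thesis by simp
        qed
        ultimately show ?thesis using c x unfolding powr_add by (intro mult_mono) auto
      qed
      finally have "D * (c * K) powr (1 - \<beta>) * y powr \<beta> \<le> D * ((3 * c) * ((1 + x) powr (- \<kappa>) * (2 * x powr \<alpha>))) * y powr \<beta>"
        using D by (intro mult_right_mono mult_left_mono) auto
      also have "\<dots> = (6 * c * D) * ((1 + x) powr (- \<kappa>) * x powr \<alpha> * y powr \<beta>)" by simp
      also have "\<dots> \<le> B * ((1 + x) powr (- \<kappa>) * x powr \<alpha> * y powr \<beta>)"
        using B by (intro mult_right_mono) auto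
      finally show ?thesis using main by (simp add: mult.assoc)
    next
      case False
      have half: "1/2 \<le> (1 + x) powr (- \<kappa>)"
      proof -
        have "(1 + x) powr \<kappa> \<le> 2 powr 1" using False x \<kappa> \<kappa>1 by (intro powr_mono_both) auto
        then show ?thesis using x by (simp add: powr_minus field_simps)
      qed
      have x1: "cmod (g z) \<le> 1" using False by (simp add: x_def)
      show ?thesis
      proof (cases "1/2 \<le> y")
        \<comment> \<open>Here \<open>y powr \<beta>\<close> is bounded below, so the estimate
          through the zeros of \<open>g\<close> alone suffices.\<close>
        case True
        have "cmod ((deriv ^^ Suc k) g z) \<le> A' * x powr \<alpha>"
          using small[OF adm der x1, of "Suc k"] \<tau>\<alpha> by (simp add: x_def)
        also have "\<dots> \<le> A' * x powr \<alpha> * (2 * (1 + x) powr (- \<kappa>)) * (2 * y powr \<beta>)"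
        proof -
          have "(1/2) powr 1 \<le> (1/2) powr \<beta>" using \<beta>1 by (intro powr_mono') auto
          also have "\<dots> \<le> y powr \<beta>" using True \<beta>(2) by (intro powr_mono2) auto
          finally have "1 * 1 \<le> (2 * (1 + x) powr (- \<kappa>)) * (2 * y powr \<beta>)"
            using half by (intro mult_mono) auto
          then have "A' * x powr \<alpha> * 1 \<le> A' * x powr \<alpha> * ((2 * (1 + x) powr (- \<kappa>)) * (2 * y powr \<beta>))"
            using A'0 by (intro mult_left_mono) auto
          then show ?thesis by (simp add: mult.assoc)
        qed
        also have "\<dots> = (A' * 4) * ((1 + x) powr (- \<kappa>) * x powr \<alpha> * y powr \<beta>)" by simp
        also have "\<dots> \<le> B * ((1 + x) powr (- \<kappa>) * x powr \<alpha> * y powr \<beta>)"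
          using B by (intro mult_right_mono) auto
        finally show ?thesis by (simp add: mult.assoc)
      next
        case False
        \<comment> \<open>The \<open>k\<close>-th derivative is close to \<open>1\<close>, so \<open>g z\<close> cannot be too small.\<close>
        have "1 - cmod ((deriv ^^ k) g z) \<le> y"
          using norm_triangle_ineq2[of 1 "(deriv ^^ k) g z"] by (simp add: y_def h_def norm_minus_commute)
        then have "1/2 \<le> cmod ((deriv ^^ k) g z)" using False by simp
        also have "\<dots> \<le> A' * x powr \<tau> k" using small[OF adm der x1, of k] by (simp add: x_def)
        also have "\<dots> \<le> A' * x powr \<alpha>"
          using A'0 \<tau>_mono[of k "Suc k"] \<tau>\<alpha> x1 x by (intro mult_left_mono powr_mono') (auto simp: x_def)
        finally have xA: "1 \<le> 2 * (A' * x powr \<alpha>)" by simp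
        have "(1 + x) powr (1 + \<eta>) \<le> 2 powr 2"
          using x1 x \<eta> by (intro powr_mono_both) (auto simp: x_def)
        then have "K \<le> 12" by (simp add: K_def)
        then have "c * K \<le> c * 12" using c by (intro mult_left_mono) auto
        moreover have "1 * 1 \<le> c * K" using c K1 by (intro mult_mono) auto
        then have "(c * K) powr (1 - \<beta>) \<le> (c * K) powr 1" using \<beta>(2) by (intro powr_mono) auto
        ultimately have "(c * K) powr (1 - \<beta>) \<le> c * 12" using cK by simp
        then have "D * (c * K) powr (1 - \<beta>) * y powr \<beta> \<le> D * (c * 12) * y powr \<beta>"
          using D by (intro mult_right_mono mult_left_mono) auto
        also have "\<dots> = 12 * c * D * y powr \<beta> * 1" by simp
        also have "\<dots> \<le> 12 * c * D * y powr \<beta> * ((2 * (A' * x powr \<alpha>)) * (2 * (1 + x) powr (- \<kappa>)))"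
        proof -
          have "1 * 1 \<le> (2 * (A' * x powr \<alpha>)) * (2 * (1 + x) powr (- \<kappa>))"
            using xA half by (intro mult_mono) auto
          then show ?thesis using c D by (intro mult_left_mono) auto
        qed
        also have "\<dots> = (48 * c * D * A') * ((1 + x) powr (- \<kappa>) * x powr \<alpha> * y powr \<beta>)" by simp
        also have "\<dots> \<le> B * ((1 + x) powr (- \<kappa>) * x powr \<alpha> * y powr \<beta>)"
          using B by (intro mult_right_mono) auto
        finally show ?thesis using main by (simp add: mult.assoc)
      qed
    qed
    then show "cmod ((deriv ^^ Suc k) g z) \<le>
        B * (1 + cmod (g z)) powr (- \<kappa>) * cmod (g z) powr \<alpha> * cmod ((deriv ^^ k) g z - 1) powr \<beta>"
      by (simp add: x_def y_def h_def)
  qed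
qed

section \<open>Integer exponents and the holomorphic quotient\<close>

definition tame :: "real \<Rightarrow> nat \<Rightarrow> nat \<Rightarrow> nat \<Rightarrow> complex set \<Rightarrow> (complex \<Rightarrow> complex) \<Rightarrow> bool" where
  "tame C k m n S g \<longleftrightarrow> admissible k m n S g \<and> (\<forall>w\<in>S. cmod (deriv g w) \<le> C * growth (cmod (g w)))"

lemma tame_subset: "tame C k m n S f \<Longrightarrow> T \<subseteq> S \<Longrightarrow> tame C k m n T f"
  by (auto simp: tame_def intro: admissible_subset)

lemma powr_power_eq:
  fixes x :: real assumes "0 \<le> x" "0 < c" "real a = N * c" "0 < N"
  shows "(x powr c) ^ N = x ^ a"
proof (cases "x = 0")
  case True
  have "0 < real a" using assms by simp
  then have "0 < a" by simp
  then show ?thesis using True assms by (simp add: power_0_left)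
next
  case False
  then have "(x powr c) ^ N = x powr real a"
    using assms by (simp add: powr_realpow[symmetric] powr_powr mult.commute)
  then show ?thesis using False assms by (metis order_le_less powr_realpow)
qed

text \<open>The N-th power replaces the real exponents by integers: apart from the decaying weight,
  the right side becomes the modulus of the holomorphic function g^a (h - 1)^b, where h is the k-th
  derivative of \<open>g\<close>. The constant max B (B^N) serves both bounds.\<close>

lemma tame_bounds:
  assumes pos: "k > 0" "m > 0" "n > 0" and less: "(real k + 1) / real m + 1 / real n < 1" and C: "0 < C"
  obtains \<delta> B \<tau> \<nu> :: real and N a b :: nat where
    "0 < \<delta>" "\<delta> \<le> 1" "0 < B" "0 < \<tau>" "0 < \<nu>" "0 < N"
    "\<And>g z j. tame C k m n (ball z \<delta>) g \<Longrightarrow> j \<le> k \<Longrightarrow> cmod (g z) \<le> 1 \<Longrightarrow>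
      cmod ((deriv ^^ j) g z) \<le> B * cmod (g z) powr \<tau>"
    "\<And>g z. tame C k m n (ball z \<delta>) g \<Longrightarrow>
      cmod ((deriv ^^ Suc k) g z) ^ N \<le>
        B * (1 + cmod (g z)) powr (- \<nu>) * (cmod (g z) ^ a * cmod ((deriv ^^ k) g z - 1) ^ b)"
proof -
  obtain \<eta> \<alpha> \<beta> \<kappa> :: real and N a b :: nat where
    \<eta>: "0 < \<eta>" "\<eta> \<le> 1" and \<alpha>: "\<alpha> = 1 - (real k + 1) / real m - \<eta>" "0 < \<alpha>"
    and \<beta>: "\<beta> = 1 - 1 / real n - \<eta>" "0 < \<beta>"
    and \<kappa>: "\<kappa> = \<alpha> - (1 + \<eta>) * (1 - \<beta>)" "0 < \<kappa>" and N: "0 < N" "real a = N * \<alpha>" "real b = N * \<beta>"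
    using exponents_exist[OF pos less] by metis
  have "(real k + 1) / real m < 1" using \<alpha> \<eta> by linarith
  then have km: "k + 1 < m" using pos by (simp add: field_simps)
  have "1 / real n < 1" using \<beta> \<eta> by linarith
  then have n: "1 < n" using pos by (simp add: field_simps)
  obtain \<delta> B where \<delta>: "0 < \<delta>" "\<delta> \<le> 1" and B: "0 < B" and
    1: "\<And>g z j. admissible k m n (ball z \<delta>) g \<Longrightarrow>
      (\<And>w. w \<in> ball z \<delta> \<Longrightarrow> cmod (deriv g w) \<le> C * growth (cmod (g w))) \<Longrightarrow> j \<le> k \<Longrightarrow> cmod (g z) \<le> 1 \<Longrightarrow>
      cmod ((deriv ^^ j) g z) \<le> B * cmod (g z) powr (1 - real k / real m - \<eta>)" and
    2: "\<And>g z. admissible k m n (ball z \<delta>) g \<Longrightarrow>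
      (\<And>w. w \<in> ball z \<delta> \<Longrightarrow> cmod (deriv g w) \<le> C * growth (cmod (g w))) \<Longrightarrow>
      cmod ((deriv ^^ Suc k) g z) \<le>
        B * (1 + cmod (g z)) powr (- \<kappa>) * cmod (g z) powr \<alpha> * cmod ((deriv ^^ k) g z - 1) powr \<beta>"
    using pointwise_bounds[OF \<eta> \<alpha> \<beta> \<kappa> km n C] by blast
  have \<tau>: "0 < 1 - real k / real m - \<eta>" using \<alpha> pos by (simp add: add_divide_distrib) (smt (verit) divide_nonneg_nonneg of_nat_0_le_iff)
  show ?thesis
  proof (rule that[OF \<delta> _ \<tau> _ N(1)])
    show "0 < max B (B ^ N)" "0 < \<kappa> * N" using B \<kappa> N by auto
    fix g z assume t: "tame C k m n (ball z \<delta>) g"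
    { fix j assume "j \<le> k" "cmod (g z) \<le> 1"
      then have "cmod ((deriv ^^ j) g z) \<le> B * cmod (g z) powr (1 - real k / real m - \<eta>)"
        using 1 t by (auto simp: tame_def)
      also have "\<dots> \<le> max B (B ^ N) * cmod (g z) powr (1 - real k / real m - \<eta>)"
        by (intro mult_right_mono) auto
      finally show "cmod ((deriv ^^ j) g z) \<le> max B (B ^ N) * cmod (g z) powr (1 - real k / real m - \<eta>)" . }
    have "cmod ((deriv ^^ Suc k) g z) ^ N \<le>
        (B * (1 + cmod (g z)) powr (- \<kappa>) * cmod (g z) powr \<alpha> * cmod ((deriv ^^ k) g z - 1) powr \<beta>) ^ N"
      using 2 t by (intro power_mono) (auto simp: tame_def)
    also have "\<dots> = B ^ N * ((1 + cmod (g z)) powr (- \<kappa>)) ^ N * (cmod (g z) ^ a * cmod ((deriv ^^ k) g z - 1) ^ b)"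
      using \<alpha> \<beta> N by (simp add: power_mult_distrib powr_power_eq)
    also have "((1 + cmod (g z)) powr (- \<kappa>)) ^ N = (1 + cmod (g z)) powr (- (\<kappa> * N))"
      using add_pos_nonneg[OF zero_less_one norm_ge_zero[of "g z"]]
      by (subst powr_realpow[symmetric]) (auto simp: powr_powr)
    also have "B ^ N * (1 + cmod (g z)) powr (- (\<kappa> * N)) * (cmod (g z) ^ a * cmod ((deriv ^^ k) g z - 1) ^ b) \<le>
       max B (B ^ N) * (1 + cmod (g z)) powr (- (\<kappa> * N)) * (cmod (g z) ^ a * cmod ((deriv ^^ k) g z - 1) ^ b)"
      by (intro mult_right_mono) auto
    finally show "cmod ((deriv ^^ Suc k) g z) ^ N \<le>
        max B (B ^ N) * (1 + cmod (g z)) powr (- (\<kappa> * N)) * (cmod (g z) ^ a * cmod ((deriv ^^ k) g z - 1) ^ b)" .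
  qed
qed

text \<open>Compactness of the closure leaves finitely many zeros of \<open>q\<close> in
  \<open>T\<close>, and the continuous bound \<open>M\<close> makes them removable for p / q. At
  such a zero p = Q q holds because the bound forces \<open>p\<close> to vanish there, and the bound
  on \<open>Q\<close> follows by passing to the limit.\<close>

lemma bounded_quotient_extends:
  assumes p: "p holomorphic_on S" and q: "q holomorphic_on S" and S: "open S" "connected S"
    and T: "open T" "compact (closure T)" "closure T \<subseteq> S" and nz: "\<exists>z\<in>S. q z \<noteq> 0"
    and M: "continuous_on S M" and le: "\<And>z. z \<in> T \<Longrightarrow> cmod (p z) \<le> M z * cmod (q z)"
  obtains Q where "Q holomorphic_on T" "\<And>z. z \<in> T \<Longrightarrow> p z = Q z * q z" "\<And>z. z \<in> T \<Longrightarrow> cmod (Q z) \<le> M z"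
proof -
  have TS: "T \<subseteq> S" using T(3) closure_subset by blast
  define X where "X = {z \<in> T. q z = 0}"
  have "finite X"
  proof (cases "q constant_on S")
    case True
    then have "X = {}" using nz TS by (auto simp: constant_on_def X_def)
    then show ?thesis by simp
  next
    case False
    have "finite {z \<in> closure T. q z = 0}"
      by (rule holomorphic_compact_finite_zeros[OF q S T(2,3) False])
    then show ?thesis by (rule rev_finite_subset) (use closure_subset in \<open>auto simp: X_def\<close>)
  qed
  have tM: "(M \<longlongrightarrow> M z) (at z)" if "z \<in> T" for z
    using M that T(1) TS S by (metis continuous_on_eq_continuous_at isCont_def subsetD)
  have off: "\<forall>\<^sub>F w in at z. w \<in> T - X" if "z \<in> T" for z
  proof -
    have "open (T - (X - {z}))" using T(1) \<open>finite X\<close> by (simp add: open_Diff finite_imp_closed)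
    then show ?thesis using that by (auto simp: eventually_at_topological)
  qed
  have bd: "cmod (p z / q z) \<le> M z" if "z \<in> T - X" for z
    using le[of z] that by (simp add: X_def norm_divide divide_le_eq)
  have "\<exists>Q. Q holomorphic_on T \<and> (\<forall>z\<in>T - X. Q z = p z / q z)"
  proof (rule removable_singularities[OF \<open>finite X\<close>])
    show "X \<subseteq> interior T" using T(1) by (auto simp: X_def interior_open)
    show "(\<lambda>z. p z / q z) holomorphic_on T - X"
      using TS by (intro holomorphic_intros holomorphic_on_subset[OF p] holomorphic_on_subset[OF q]) (auto simp: X_def)
    fix z assume "z \<in> X"
    then have zT: "z \<in> T" by (simp add: X_def)
    have "\<forall>\<^sub>F w in at z. M w < M z + 1" using tM[OF zT] by (rule order_tendstoD) simp
    then have "\<forall>\<^sub>F w in at z. norm (p w / q w) \<le> (M z + 1) * norm (1::real)"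
      using off[OF zT] by eventually_elim (use bd in fastforce)
    then show "(\<lambda>z. p z / q z) \<in> O[at z](\<lambda>_. 1)"
      by (intro landau_o.bigI[of "\<bar>M z + 1\<bar> + 1"]) (auto elim!: eventually_mono)
  qed
  then obtain Q where Q: "Q holomorphic_on T" "\<And>z. z \<in> T - X \<Longrightarrow> Q z = p z / q z" by blast
  have tQ: "(Q \<longlongrightarrow> Q z) (at z)" if "z \<in> T" for z
    using Q(1) that T(1) by (meson continuous_on_eq_continuous_at holomorphic_on_imp_continuous_on isCont_def)
  have le': "cmod (Q z) \<le> M z" if z: "z \<in> T" for z
  proof (rule tendsto_le[OF _ tM[OF z] tendsto_norm[OF tQ[OF z]]])
    show "\<forall>\<^sub>F w in at z. cmod (Q w) \<le> M w"
      using off[OF z] by eventually_elim (use Q(2) bd in auto)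
  qed auto
  moreover have "p z = Q z * q z" if "z \<in> T" for z
    using Q(2)[of z] le[of z] that by (cases "q z = 0") (auto simp: X_def)
  ultimately show ?thesis using that Q(1) by blast
qed

lemma bounded_on_ball_of_tame:
  assumes f: "f holomorphic_on ball 0 R" and le: "\<And>w. w \<in> ball 0 R \<Longrightarrow> cmod (deriv f w) \<le> C * growth (cmod (f w))"
    and A: "cmod (f 0) \<le> A" and w: "w \<in> ball 0 R" and C: "0 < C" "cmod w \<le> s"
  shows "cmod (f w) \<le> exp (exp (4 * C * s) * loggrowth A)"
proof (rule loggrowth_le_imp_le)
  have R: "0 < R" using w by (simp add: dist_norm) (smt (verit) norm_ge_zero)
  have "loggrowth (cmod (f w)) \<le> exp (4 * C * cmod (w - 0)) * loggrowth (cmod (f 0))"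
    using R w by (intro loggrowth_Lipschitz[OF f _ _ le]) auto
  also have "\<dots> \<le> exp (4 * C * s) * loggrowth A"
  proof (intro mult_mono)
    have "(cmod (f 0))\<^sup>2 \<le> A\<^sup>2" using A by (intro power_mono) auto
    then show "loggrowth (cmod (f 0)) \<le> loggrowth A"
      by (simp add: loggrowth_def add_pos_nonneg)
    show "0 \<le> loggrowth (cmod (f 0))" using loggrowth_ge_1 by (meson order_trans zero_le_one)
  qed (use C in auto)
  finally show "loggrowth (cmod (f w)) \<le> exp (4 * C * s) * loggrowth A" .
qed

subsection \<open>Excluding the rescaled limit\<close>

text \<open>A quantitative Liouville theorem for Q = p / q. It is bounded by \<open>B\<close> on a
  huge disc, hence nearly constant on a smaller one; that disc contains a point where |g| is large,
  and there the weight makes Q small. So Q is small everywhere on the smaller disc, and p = Q q is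
  small wherever \<open>q\<close> is under control.\<close>

lemma higher_deriv_small:
  assumes pos: "k > 0" "m > 0" "n > 0" and less: "(real k + 1) / real m + 1 / real n < 1" and C: "0 < C"
    and \<epsilon>: "0 < \<epsilon>" and s0: "0 < s0"
  shows "\<exists>R. \<forall>g. tame C k m n (ball 0 R) g \<longrightarrow> cmod (g 0) \<le> A \<longrightarrow> 1 \<le> cmod (deriv g 0) \<longrightarrow>
           (\<forall>z\<in>ball 0 s0. cmod ((deriv ^^ Suc k) g z) < \<epsilon>)"
proof -
  obtain \<delta> B \<tau> \<nu> :: real and N a b :: nat where \<delta>: "0 < \<delta>" "\<delta> \<le> 1" and B: "0 < B" and \<nu>: "0 < \<nu>" and N: "0 < N"
    and bd: "\<And>g z. tame C k m n (ball z \<delta>) g \<Longrightarrow>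
      cmod ((deriv ^^ Suc k) g z) ^ N \<le>
        B * (1 + cmod (g z)) powr (- \<nu>) * (cmod (g z) ^ a * cmod ((deriv ^^ k) g z - 1) ^ b)"
    using tame_bounds[OF pos less C] by metis
  \<comment> \<open>\<open>A2\<close> bounds |g| on the ball of radius \<open>s0 + 1\<close>,
    \<open>A3\<close> bounds |h - 1| on the ball of radius \<open>s0\<close>, h being the k-th
    derivative, and \<open>E\<close> bounds |q| there. None of them depends on the radius still to
    be chosen.\<close>
  define A2 where "A2 = exp (exp (4 * C * (s0 + 1)) * loggrowth A)"
  define A3 where "A3 = fact k * A2 / (1/2) ^ k + 1"
  define E where "E = A2 ^ a * A3 ^ b"
  have A2: "0 < A2" by (simp add: A2_def)
  then have A3: "0 < A3" by (simp add: A3_def add_pos_pos)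
  have E: "0 < E" using A2 A3 by (simp add: E_def)
  \<comment> \<open>The variation of Q and its value at one point will each contribute at most
    \<open>t\<close>, and 2 t E = \<epsilon>^N.\<close>
  define t where "t = \<epsilon> ^ N / (2 * E)"
  have t: "0 < t" using E \<epsilon> by (simp add: t_def)
  have "filterlim (\<lambda>s::real. 1 + s / 2) at_top at_top"
    unfolding filterlim_at_top
  proof
    fix Z :: real
    show "\<forall>\<^sub>F s in at_top. Z \<le> 1 + s / 2"
      using eventually_ge_at_top[of "2 * Z"] by eventually_elim simp
  qed
  then have "((\<lambda>s. B * (1 + s / 2) powr (- \<nu>)) \<longlongrightarrow> B * 0) at_top"
    by (intro tendsto_intros tendsto_neg_powr) (use \<nu> in auto)
  then have "\<forall>\<^sub>F s in at_top. B * (1 + s / 2) powr (- \<nu>) < t" using t by (simp add: order_tendsto_iff)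
  then have "\<forall>\<^sub>F s in at_top. s0 \<le> s \<and> B * (1 + s / 2) powr (- \<nu>) < t"
    using eventually_ge_at_top[of s0] by eventually_elim auto
  then obtain s where s: "s0 \<le> s" "B * (1 + s / 2) powr (- \<nu>) < t"
    by (auto simp: eventually_at_top_linorder)
  have spos: "0 < s" using s s0 by simp
  \<comment> \<open>Two points of the ball of radius \<open>s\<close> are less than 2 s apart and
    |Q'| \<le> 2 B / (r - s) there; this \<open>r\<close> makes the product at most
    \<open>t\<close>.\<close>
  define r where "r = s + 2 + 4 * s * B / t"
  have r: "s + 2 \<le> r" using spos B t by (simp add: r_def)
  have rt: "4 * s * B / (r - s) \<le> t"
  proof -
    have "4 * s * B / t \<le> r - s" by (simp add: r_def)
    then show ?thesis using t r by (simp add: field_simps)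
  qed
  show ?thesis
  proof (intro exI[of _ "r + 2"] allI impI ballI)
    fix g and z :: complex
    assume tame: "tame C k m n (ball 0 (r + 2)) g" and A: "cmod (g 0) \<le> A"
      and d1: "1 \<le> cmod (deriv g 0)" and z: "z \<in> ball 0 s0"
    have hol: "g holomorphic_on ball 0 (r + 2)" using tame by (simp add: tame_def admissible_def)
    have der: "cmod (deriv g w) \<le> C * growth (cmod (g w))" if "w \<in> ball 0 (r + 2)" for w
      using tame that by (simp add: tame_def)
    have holk: "(deriv ^^ j) g holomorphic_on ball 0 (r + 2)" for j
      using holomorphic_higher_deriv[OF hol open_ball] .
    define p where "p = (\<lambda>z. (deriv ^^ Suc k) g z ^ N)"
    define q where "q = (\<lambda>z. g z ^ a * ((deriv ^^ k) g z - 1) ^ b)"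
    define M where "M = (\<lambda>z. B * (1 + cmod (g z)) powr (- \<nu>))"
    have MB: "M w \<le> B" for w
    proof -
      have "(1 + cmod (g w)) powr (- \<nu>) \<le> (1 + cmod (g w)) powr 0" using \<nu> by (intro powr_mono) auto
      then show ?thesis using B by (simp add: M_def mult_le_cancel_left2 add_pos_nonneg split: if_splits)
    qed
    have pq: "cmod (p w) \<le> M w * cmod (q w)" if w: "w \<in> ball 0 (r + 1)" for w
    proof -
      have "tame C k m n (ball w \<delta>) g"
      proof (rule tame_subset[OF tame])
        show "ball w \<delta> \<subseteq> ball 0 (r + 2)"
        proof
          fix v assume "v \<in> ball w \<delta>"
          then show "v \<in> ball 0 (r + 2)" using w \<delta> dist_triangle[of 0 v w] by simp
        qed
      qed
      then show ?thesis using bd[of w g] by (simp add: p_def q_def M_def norm_mult norm_power)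
    qed
    have "cmod (p z) < \<epsilon> ^ N"
    proof (cases "\<exists>z\<in>ball 0 (r + 1). q z \<noteq> 0")
      \<comment> \<open>If \<open>q\<close> vanishes identically, no quotient can be formed, but the
        bound already gives p = 0.\<close>
      case False
      then have "p z = 0" using pq[of z] z s r by auto
      then show ?thesis using \<epsilon> by simp
    next
      case True
      obtain Q where Q: "Q holomorphic_on ball 0 r" and Qeq: "\<And>z. z \<in> ball 0 r \<Longrightarrow> p z = Q z * q z"
        and QM: "\<And>z. z \<in> ball 0 r \<Longrightarrow> cmod (Q z) \<le> M z"
      proof (rule bounded_quotient_extends[of p "ball 0 (r + 1)" q "ball 0 r" M])
        have sub: "ball 0 (r + 1) \<subseteq> ball 0 (r + 2)" by auto
        show "p holomorphic_on ball 0 (r + 1)" unfolding p_def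
          by (intro holomorphic_on_power holomorphic_on_subset[OF holk sub])
        show "q holomorphic_on ball 0 (r + 1)" unfolding q_def
          by (intro holomorphic_on_power holomorphic_on_mult holomorphic_on_diff holomorphic_on_const
                holomorphic_on_subset[OF holk sub] holomorphic_on_subset[OF hol sub])
        have "continuous_on (ball 0 (r + 1)) g"
          by (intro holomorphic_on_imp_continuous_on holomorphic_on_subset[OF hol sub])
        moreover have "1 + cmod (g x) \<noteq> 0" for x using norm_ge_zero[of "g x"] by linarith
        ultimately show "continuous_on (ball 0 (r + 1)) M" unfolding M_def
          by (intro continuous_intros) auto
        show "closure (ball 0 r) \<subseteq> ball (0::complex) (r + 1)" using r spos by auto
      qed (use True pq in auto)
      \<comment> \<open>Otherwise Cauchy's estimate with radius 3 s / 4 would give |g'(0)| \<le>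
        2/3.\<close>
      have "\<exists>w\<in>ball 0 s. s / 2 \<le> cmod (g w)"
      proof (rule ccontr)
        assume "\<not> ?thesis"
        then have lt: "cmod (g w) \<le> s / 2" if "w \<in> ball 0 s" for w using that by force
        have "cmod ((deriv ^^ 1) g 0) \<le> fact 1 * (s / 2) / (3 * s / 4) ^ 1"
          by (rule Cauchy_deriv_bound_ball[of g 0 s]) (use spos lt r in \<open>auto intro!: holomorphic_on_subset[OF hol]\<close>)
        also have "\<dots> < 1" using spos by simp
        finally show False using d1 by simp
      qed
      then obtain w where w: "w \<in> ball 0 s" "s / 2 \<le> cmod (g w)" by blast
      have "cmod (Q z - Q w) \<le> 2 * B / (r - s) * cmod (z - w)"
      proof (rule field_differentiable_bound[of "ball 0 s" Q "deriv Q"])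
        fix x assume x: "x \<in> ball (0::complex) s"
        then show "(Q has_field_derivative deriv Q x) (at x within ball 0 s)"
          using r by (intro holomorphic_derivI[OF Q]) auto
        have sub: "ball x (r - s) \<subseteq> ball 0 r"
        proof
          fix v assume "v \<in> ball x (r - s)"
          then show "v \<in> ball 0 r" using x dist_triangle[of 0 v x] by simp
        qed
        have "cmod ((deriv ^^ 1) Q x) \<le> fact 1 * B / ((r - s) / 2) ^ 1"
        proof (rule Cauchy_deriv_bound_ball)
          show "Q holomorphic_on ball x (r - s)" using holomorphic_on_subset[OF Q sub] .
          show "cmod (Q v) \<le> B" if "v \<in> ball x (r - s)" for v
            using QM[of v] MB[of v] sub that by (meson order_trans subsetD)
        qed (use r in auto)
        then show "cmod (deriv Q x) \<le> 2 * B / (r - s)" by (simp add: mult.commute)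
      qed (use z w s in auto)
      also have "\<dots> \<le> 2 * B / (r - s) * (2 * s)"
      proof (rule mult_left_mono)
        have "cmod (z - w) \<le> cmod z + cmod w" by (rule norm_triangle_ineq4)
        then show "cmod (z - w) \<le> 2 * s" using z w s by simp
      qed (use B r in auto)
      also have "\<dots> \<le> t" using rt by (simp add: mult_ac)
      finally have "cmod (Q z - Q w) \<le> t" .
      moreover have "cmod (Q w) < t"
      proof -
        have "cmod (Q w) \<le> M w" using QM w r by auto
        also have "\<dots> \<le> B * (1 + s / 2) powr (- \<nu>)"
          unfolding M_def using B \<nu> w spos by (intro mult_left_mono powr_mono2') auto
        finally show ?thesis using s by simp
      qed
      ultimately have Qz: "cmod (Q z) < 2 * t" using norm_triangle_ineq[of "Q z - Q w" "Q w"] by simp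
      have gA2: "cmod (g x) \<le> A2" if "x \<in> ball 0 (s0 + 1)" for x
        unfolding A2_def by (rule bounded_on_ball_of_tame[OF hol der A _ C]) (use that s r in auto)
      have sub: "ball z 1 \<subseteq> ball 0 (s0 + 1)"
      proof
        fix v assume "v \<in> ball z 1"
        then show "v \<in> ball 0 (s0 + 1)" using z dist_triangle[of 0 v z] by simp
      qed
      have "ball z 1 \<subseteq> ball 0 (r + 2)" using sub s r by auto
      then have "cmod ((deriv ^^ k) g z) \<le> fact k * A2 / (1/2) ^ k"
        using gA2 sub by (intro Cauchy_deriv_bound_ball[of g z 1]) (auto intro: holomorphic_on_subset[OF hol])
      then have "cmod ((deriv ^^ k) g z - 1) \<le> A3"
        unfolding A3_def using norm_triangle_ineq4[of "(deriv ^^ k) g z" 1] by simp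
      then have "cmod (q z) \<le> E"
        unfolding q_def E_def norm_mult norm_power using gA2[of z] z A2
        by (intro mult_mono power_mono) auto
      then have "cmod (Q z) * cmod (q z) \<le> cmod (Q z) * E" by (intro mult_left_mono) auto
      also have "\<dots> < 2 * t * E" using Qz E by (intro mult_strict_right_mono)
      also have "\<dots> = \<epsilon> ^ N" using E by (simp add: t_def)
      finally show ?thesis using Qeq[of z] z s r by (simp add: norm_mult)
    qed
    then have "cmod ((deriv ^^ Suc k) g z) ^ N < \<epsilon> ^ N" by (simp add: p_def norm_power)
    then show "cmod ((deriv ^^ Suc k) g z) < \<epsilon>" 
      by (rule power_less_imp_less_base) (use \<epsilon> in simp)
  qed
qed

text \<open>If p(0) is not 0, then p'(0) / p(0) is minus the sum of the reciprocals of the roots,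
  each of modulus at most 1 / \<rho> when \<rho> > 0. The multiplied-out form survives p(0) = 0 and
  can be proved by splitting off one root at a time.\<close>

lemma coeff_1_bound_of_no_roots:
  fixes p :: "complex poly"
  assumes "\<And>z. poly p z = 0 \<Longrightarrow> \<rho> \<le> cmod z"
  shows "cmod (coeff p 1) * \<rho> \<le> real (degree p) * cmod (coeff p 0)"
  using assms
proof (induction "degree p" arbitrary: p)
  case 0
  then have "coeff p 1 = 0" by (intro coeff_eq_0) simp
  then show ?case by simp
next
  case (Suc d)
  have "coeff p (degree p) \<noteq> 0" "degree p \<in> {1..degree p}" using Suc.hyps(2) by auto
  then obtain a where "(\<Sum>i\<le>degree p. coeff p i * a ^ i) = 0"
    using fundamental_theorem_of_algebra[of "coeff p" "degree p"] by metis
  then have a: "poly p a = 0" by (simp add: poly_altdef)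
  from a obtain q where q: "p = [:- a, 1:] * q" unfolding poly_eq_0_iff_dvd dvd_def by blast
  have q0: "q \<noteq> 0" using Suc.hyps(2) q by auto
  have "degree p = degree [:- a, 1:] + degree q" unfolding q by (rule degree_mult_eq) (use q0 in auto)
  then have deg: "degree q = d" using Suc.hyps(2) by simp
  have IH: "cmod (coeff q 1) * \<rho> \<le> real d * cmod (coeff q 0)"
    using Suc.hyps(1)[of q] Suc.prems deg q by (auto simp: deg)
  have c0: "coeff p 0 = - a * coeff q 0" and c1: "coeff p 1 = coeff q 0 - a * coeff q 1"
    by (simp_all add: q)
  have \<rho>: "\<rho> \<le> cmod a" using Suc.prems a by blast
  show ?case
  proof (cases "0 \<le> \<rho>")
    case True
    have "cmod (coeff p 1) * \<rho> \<le> (cmod (coeff q 0) + cmod a * cmod (coeff q 1)) * \<rho>"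
      unfolding c1 using True norm_triangle_ineq4[of "coeff q 0" "a * coeff q 1"]
      by (intro mult_right_mono) (auto simp: norm_mult)
    also have "\<dots> \<le> cmod (coeff q 0) * cmod a + cmod a * (real d * cmod (coeff q 0))"
      using mult_left_mono[OF \<rho>, of "cmod (coeff q 0)"] mult_left_mono[OF IH, of "cmod a"]
      by (simp add: algebra_simps)
    also have "\<dots> = real (degree p) * cmod (coeff p 0)"
      by (simp add: c0 norm_mult algebra_simps flip: Suc.hyps(2))
    finally show ?thesis .
  next
    case False
    then have "cmod (coeff p 1) * \<rho> \<le> 0" by (simp add: mult_le_0_iff)
    then show ?thesis by (meson mult_nonneg_nonneg norm_ge_zero of_nat_0_le_iff order_trans)
  qed
qed

text \<open>For the Taylor polynomial of \<open>g\<close> this yields a root in a disc whose radius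
  depends only on \<open>k\<close> and the bound for g(0), whatever the higher coefficients
  are.\<close>

lemma poly_root_near_0:
  fixes c :: "nat \<Rightarrow> complex"
  assumes k: "1 \<le> k" and c0: "cmod (c 0) \<le> A" and c1: "1 \<le> cmod (c 1)" and \<rho>: "real k * A < \<rho>"
  shows "\<exists>z. cmod z < \<rho> \<and> (\<Sum>i\<le>k. c i * z ^ i) = 0"
proof (rule ccontr)
  assume "\<not> ?thesis"
  then have no: "\<rho> \<le> cmod z" if "(\<Sum>i\<le>k. c i * z ^ i) = 0" for z
    using that by force
  define p where "p = (\<Sum>i\<le>k. monom (c i) i)"
  have pp: "poly p z = (\<Sum>i\<le>k. c i * z ^ i)" for z by (simp add: p_def poly_sum poly_monom)
  have co: "coeff p j = c j" if "j \<le> k" for j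
    using that by (simp add: p_def coeff_sum coeff_monom)
  have deg: "degree p \<le> k"
    unfolding p_def by (intro degree_sum_le) (auto intro: order_trans[OF degree_monom_le])
  have A: "0 \<le> A" using c0 norm_ge_zero order_trans by blast
  have "0 \<le> real k * A" using A by simp
  then have "0 \<le> \<rho>" using \<rho> by linarith
  then have "\<rho> \<le> cmod (c 1) * \<rho>" using c1 by (simp add: mult_le_cancel_right1)
  also have "\<dots> \<le> real (degree p) * cmod (c 0)"
    using coeff_1_bound_of_no_roots[of p \<rho>] no co[of 0] co[of 1] k by (simp add: pp)
  also have "\<dots> \<le> real k * A" using deg c0 by (intro mult_mono) auto
  finally show False using \<rho> by simp
qed

text \<open>If |g| \<le> 1 somewhere in the disc, \<open>loggrowth_Lipschitz\<close> carries the
  bound to 0. Otherwise ln g has positive real part, and \<open>deriv_bound_of_Re_pos\<close> gives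
  |g'(0)| \<le> |g(0)| ln |g(0)|, less than \<open>growth\<close>. The radius 5 exceeds the constant
  4 of that estimate, and 20 = 4 * 5 is the resulting Lipschitz exponent.\<close>

lemma initial_value_bound:
  assumes C: "0 < C" and g: "g holomorphic_on ball 0 5"
    and le: "\<And>w. w \<in> ball 0 5 \<Longrightarrow> cmod (deriv g w) \<le> C * growth (cmod (g w))"
    and big: "growth (cmod (g 0)) \<le> cmod (deriv g 0)"
  shows "cmod (g 0) \<le> exp (exp (20 * C) * loggrowth 1)"
proof (cases "\<exists>w\<in>ball 0 5. cmod (g w) \<le> 1")
  case True
  then obtain w where w: "w \<in> ball 0 5" "cmod (g w) \<le> 1" by blast
  have "loggrowth (cmod (g 0)) \<le> exp (4 * C * cmod (0 - w)) * loggrowth (cmod (g w))"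
    using w by (intro loggrowth_Lipschitz[OF g _ _ le]) auto
  also have "\<dots> \<le> exp (20 * C) * loggrowth 1"
  proof (intro mult_mono)
    show "exp (4 * C * cmod (0 - w)) \<le> exp (20 * C)" using w C by simp
    have "(cmod (g w))\<^sup>2 \<le> 1\<^sup>2" using w by (intro power_mono) auto
    then show "loggrowth (cmod (g w)) \<le> loggrowth 1" by (simp add: loggrowth_def add_pos_nonneg)
    show "0 \<le> loggrowth (cmod (g w))" using loggrowth_ge_1 by (meson order_trans zero_le_one)
  qed auto
  finally show ?thesis by (rule loggrowth_le_imp_le)
next
  case False
  then have gt: "1 < cmod (g w)" if "w \<in> ball 0 5" for w using that by force
  obtain G where G: "G holomorphic_on ball 0 5" "\<And>x. x \<in> ball 0 5 \<Longrightarrow> exp (G x) = g x"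
  proof (rule holomorphic_logarithm_exists[of "ball 0 5" g 0])
    show "g x \<noteq> 0" if "x \<in> ball 0 5" for x using gt[OF that] by auto
  qed (use g in auto)
  have ReG: "Re (G x) = ln (cmod (g x))" if "x \<in> ball 0 5" for x
    using G(2)[OF that] by (metis ln_exp norm_exp_eq_Re)
  define x where "x = cmod (g 0)"
  have x: "1 < x" using gt by (simp add: x_def)
  have "cmod (deriv G 0) \<le> 4 * Re (G 0) / 5"
  proof (intro deriv_bound_of_Re_pos G)
    show "0 < Re (G w)" if "w \<in> ball 0 5" for w 
      unfolding ReG[OF that] using gt[OF that] by (rule ln_gt_zero)
  qed simp
  also have "\<dots> \<le> ln x" using x by (simp add: ReG x_def)
  finally have dG: "cmod (deriv G 0) \<le> ln x" .
  have "(G has_field_derivative deriv G 0) (at 0)" using G(1) by (intro holomorphic_derivI) auto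
  then have "((\<lambda>x. exp (G x)) has_field_derivative exp (G 0) * deriv G 0) (at 0)"
    by (auto intro!: derivative_eq_intros)
  then have "(g has_field_derivative exp (G 0) * deriv G 0) (at 0)"
    by (rule has_field_derivative_transform_within_open[of _ _ _ "ball 0 5"]) (use G in auto)
  then have "deriv g 0 = g 0 * deriv G 0" using G(2)[of 0] by (simp add: DERIV_imp_deriv)
  then have "cmod (deriv g 0) = x * cmod (deriv G 0)" by (simp add: norm_mult x_def)
  also have "\<dots> \<le> x * ln x" using dG x by (intro mult_left_mono) auto
  also have "\<dots> < (1 + x) * (1 + ln (1 + x\<^sup>2))"
  proof (rule mult_strict_mono)
    have "x \<le> 1 + x\<^sup>2" using x power2_eq_square[of x] mult_left_mono[of 1 x x] by linarith
    then have "ln x \<le> ln (1 + x\<^sup>2)" using x by simp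
    then show "ln x < 1 + ln (1 + x\<^sup>2)" by simp
  qed (use x in auto)
  also have "\<dots> = growth x" by (simp add: growth_def loggrowth_def)
  finally show ?thesis using big by (simp add: x_def)
qed

text \<open>The finite-radius substitute for the nonexistence of a rescaled limit. The opposite
  inequality at 0 would give |g'(0)| \<ge> 1 and, by \<open>initial_value_bound\<close>, |g(0)|
  \<le> A, so every constant below is independent of \<open>g\<close>.\<close>

lemma tame_deriv_less_growth:
  assumes pos: "k > 0" "m > 0" "n > 0" and less: "(real k + 1) / real m + 1 / real n < 1" and C: "0 < C"
  shows "\<exists>R>0. \<forall>g. tame C k m n (ball 0 R) g \<longrightarrow> cmod (deriv g 0) < growth (cmod (g 0))"
proof -
  define A where "A = exp (exp (20 * C) * loggrowth 1)"
  \<comment> \<open>The root found later satisfies |z| < k A + 1; the additional 1 leaves a margin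
    around it.\<close>
  define s0 where "s0 = real k * A + 2"
  have kA: "0 \<le> real k * A" by (simp add: A_def)
  then have s0: "2 \<le> s0" by (simp add: s0_def)
  obtain \<delta> B \<tau> :: real where \<delta>: "0 < \<delta>" "\<delta> \<le> 1" and B: "0 < B" and \<tau>: "0 < \<tau>"
    and bd: "\<And>g z j. tame C k m n (ball z \<delta>) g \<Longrightarrow> j \<le> k \<Longrightarrow> cmod (g z) \<le> 1 \<Longrightarrow>
      cmod ((deriv ^^ j) g z) \<le> B * cmod (g z) powr \<tau>"
    using tame_bounds[OF pos less C] by metis
  \<comment> \<open>The expression is the final bound for |g'(0)|, from a Taylor expansion of g'
    about the root: k terms, each containing a small derivative of \<open>g\<close>, plus the
    remainder. Choosing \<epsilon> to make it less than 1 yields the contradiction.\<close>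
  have "((\<lambda>\<epsilon>. real k * (B * (\<epsilon> * s0 ^ Suc k) powr \<tau> * s0 ^ k) + \<epsilon> * s0 ^ k) \<longlongrightarrow>
      real k * (B * 0 * s0 ^ k) + 0 * s0 ^ k) (at_right 0)"
  proof (intro tendsto_intros tendsto_zero_powrI[where b = \<tau>])
    show "((\<lambda>\<epsilon>. \<epsilon> * s0 ^ Suc k) \<longlongrightarrow> 0) (at_right 0)"
      by (intro tendsto_mult_left_zero tendsto_intros)
  qed (use \<tau> s0 in \<open>auto simp: eventually_at_right_less eventually_at_filter\<close>)
  then have "\<forall>\<^sub>F \<epsilon> in at_right 0. real k * (B * (\<epsilon> * s0 ^ Suc k) powr \<tau> * s0 ^ k) + \<epsilon> * s0 ^ k < 1"
    by (rule order_tendstoD) simp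
  moreover have "\<forall>\<^sub>F \<epsilon> in at_right 0. \<epsilon> < 1 / s0 ^ Suc k"
    using s0 by (intro eventually_at_rightI[of 0 "1 / s0 ^ Suc k"]) auto
  moreover have "\<forall>\<^sub>F \<epsilon> in at_right 0. (0::real) < \<epsilon>" by (rule eventually_at_right_less)
  ultimately have "\<forall>\<^sub>F \<epsilon> in at_right 0. 0 < \<epsilon> \<and> \<epsilon> < 1 / s0 ^ Suc k \<and>
     real k * (B * (\<epsilon> * s0 ^ Suc k) powr \<tau> * s0 ^ k) + \<epsilon> * s0 ^ k < 1" by eventually_elim auto
  then obtain \<epsilon> where \<epsilon>: "0 < \<epsilon>" "\<epsilon> < 1 / s0 ^ Suc k"
      "real k * (B * (\<epsilon> * s0 ^ Suc k) powr \<tau> * s0 ^ k) + \<epsilon> * s0 ^ k < 1"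
    using eventually_happens'[OF trivial_limit_at_right_real] by blast
  have \<epsilon>1: "\<epsilon> * s0 ^ Suc k \<le> 1" using \<epsilon>(2) s0 by (simp add: field_simps)
  have "0 < s0" using s0 by simp
  then obtain R0 where R0: "\<And>g z. tame C k m n (ball 0 R0) g \<Longrightarrow> cmod (g 0) \<le> A \<Longrightarrow> 1 \<le> cmod (deriv g 0) \<Longrightarrow>
      z \<in> ball 0 s0 \<Longrightarrow> cmod ((deriv ^^ Suc k) g z) < \<epsilon>"
    using higher_deriv_small[OF pos less C \<epsilon>(1), of s0 A] by blast
  define R where "R = max R0 (max 5 (s0 + 1))"
  have R: "R0 \<le> R" "5 \<le> R" "s0 + 1 \<le> R" by (auto simp: R_def)
  show ?thesis
  proof (intro exI[of _ R] conjI allI impI)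
    show "0 < R" using R by simp
    fix g assume tame: "tame C k m n (ball 0 R) g"
    show "cmod (deriv g 0) < growth (cmod (g 0))"
    proof (rule ccontr)
      assume "\<not> cmod (deriv g 0) < growth (cmod (g 0))"
      then have big: "growth (cmod (g 0)) \<le> cmod (deriv g 0)" by simp
      have d1: "1 \<le> cmod (deriv g 0)" using big growth_ge[of "cmod (g 0)"] norm_ge_zero[of "g 0"] by linarith
      have hol: "g holomorphic_on ball 0 R" using tame by (simp add: tame_def admissible_def)
      have gA: "cmod (g 0) \<le> A"
        unfolding A_def
        by (rule initial_value_bound[OF C _ _ big])
           (use tame R in \<open>auto simp: tame_def intro: holomorphic_on_subset[OF hol]\<close>)
      have hs: "cmod ((deriv ^^ Suc k) g z) \<le> \<epsilon>" if "z \<in> ball 0 s0" for z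
        using R0[OF tame_subset[OF tame subset_ball[OF R(1)]] gA d1 that] by simp
      have Dj: "((deriv ^^ j) g has_field_derivative (deriv ^^ Suc j) g z) (at z within ball 0 s0)"
        if "z \<in> ball 0 s0" for j z
        using holomorphic_derivI[OF holomorphic_higher_deriv[OF hol open_ball, of j], of z "ball 0 s0"] that R by simp
      obtain z where z: "cmod z < real k * A + 1" and root: "(\<Sum>i\<le>k. ((deriv ^^ i) g 0 / fact i) * z ^ i) = 0"
        using poly_root_near_0[of k "\<lambda>i. (deriv ^^ i) g 0 / fact i" A "real k * A + 1"] pos gA d1 by auto
      have zs: "z \<in> ball 0 s0" using z by (simp add: s0_def)
      have zle: "cmod z ^ j \<le> s0 ^ i" if "j \<le> i" for i j
      proof -
        have "cmod z ^ j \<le> s0 ^ j" using zs by (intro power_mono) auto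
        also have "\<dots> \<le> s0 ^ i" using that s0 by (intro power_increasing) auto
        finally show ?thesis .
      qed
      have fact1: "y / fact j \<le> y" if "0 \<le> y" for y :: real and j
        using that fact_ge_1[of j, where 'a = real] by (simp add: divide_le_eq mult_le_cancel_left1)
      have "cmod ((deriv ^^ 0) g z - (\<Sum>i\<le>k. (deriv ^^ i) g 0 * (z - 0) ^ i / fact i)) \<le> \<epsilon> * cmod (z - 0) ^ Suc k / fact k"
        by (rule complex_Taylor[of "ball 0 s0"]) (use Dj hs zs s0 in auto)
      then have "cmod (g z) \<le> \<epsilon> * cmod z ^ Suc k / fact k" using root by (simp add: mult.commute)
      also have "\<dots> \<le> \<epsilon> * cmod z ^ Suc k" using \<epsilon> by (intro fact1) auto
      also have "\<dots> \<le> \<epsilon> * s0 ^ Suc k" using \<epsilon> zle[of "Suc k" "Suc k"] by (intro mult_left_mono) auto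
      finally have gz: "cmod (g z) \<le> \<epsilon> * s0 ^ Suc k" .
      have "tame C k m n (ball z \<delta>) g"
      proof (rule tame_subset[OF tame])
        show "ball z \<delta> \<subseteq> ball 0 R"
        proof
          fix v assume "v \<in> ball z \<delta>"
          then show "v \<in> ball 0 R" using zs \<delta> R dist_triangle[of 0 v z] by simp
        qed
      qed
      then have "cmod ((deriv ^^ j) g z) \<le> B * cmod (g z) powr \<tau>" if "j \<le> k" for j
        using bd that gz \<epsilon>1 by auto
      moreover have "B * cmod (g z) powr \<tau> \<le> B * (\<epsilon> * s0 ^ Suc k) powr \<tau>"
        using B \<tau> gz by (intro mult_left_mono powr_mono2) auto
      ultimately have dz: "cmod ((deriv ^^ j) g z) \<le> B * (\<epsilon> * s0 ^ Suc k) powr \<tau>" if "j \<le> k" for j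
        using that by (meson order_trans)
      obtain l where l: "k = Suc l" using pos by (cases k) auto
      \<comment> \<open>Now g' is expanded about \<open>z\<close> and evaluated at 0. The order is l
        = k - 1, so that the remainder involves exactly the (k+1)-st derivative of
        \<open>g\<close>.\<close>
      have "cmod ((deriv ^^ Suc 0) g 0 - (\<Sum>i\<le>l. (deriv ^^ Suc i) g z * (0 - z) ^ i / fact i)) \<le> \<epsilon> * cmod (0 - z) ^ Suc l / fact l"
        by (rule complex_Taylor[of "ball 0 s0" l "\<lambda>i. (deriv ^^ Suc i) g"]) (use Dj[of _ "Suc _"] hs zs s0 l in auto)
      also have "\<dots> \<le> \<epsilon> * cmod (0 - z) ^ Suc l" using \<epsilon> by (intro fact1) auto
      also have "\<dots> \<le> \<epsilon> * s0 ^ k" using \<epsilon> zle[of k k] l by (intro mult_left_mono) auto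
      finally have 1: "cmod (deriv g 0 - (\<Sum>i\<le>l. (deriv ^^ Suc i) g z * (0 - z) ^ i / fact i)) \<le> \<epsilon> * s0 ^ k" by simp
      have "cmod (\<Sum>i\<le>l. (deriv ^^ Suc i) g z * (0 - z) ^ i / fact i) \<le> (\<Sum>i\<le>l. B * (\<epsilon> * s0 ^ Suc k) powr \<tau> * s0 ^ k)"
      proof (rule sum_norm_le)
        fix i assume "i \<in> {..l}"
        then have i: "Suc i \<le> k" "i \<le> k" using l by auto
        have "cmod ((deriv ^^ Suc i) g z * (0 - z) ^ i / fact i) = cmod ((deriv ^^ Suc i) g z) * cmod z ^ i / fact i"
          by (simp add: norm_mult norm_divide norm_power)
        also have "\<dots> \<le> cmod ((deriv ^^ Suc i) g z) * cmod z ^ i" by (intro fact1) auto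
        also have "\<dots> \<le> B * (\<epsilon> * s0 ^ Suc k) powr \<tau> * s0 ^ k"
          using dz[OF i(1)] zle[OF i(2)] B by (intro mult_mono) auto
        finally show "cmod ((deriv ^^ Suc i) g z * (0 - z) ^ i / fact i) \<le> B * (\<epsilon> * s0 ^ Suc k) powr \<tau> * s0 ^ k" .
      qed
      also have "\<dots> = real k * (B * (\<epsilon> * s0 ^ Suc k) powr \<tau> * s0 ^ k)" by (simp add: l)
      finally have "cmod (deriv g 0) \<le> real k * (B * (\<epsilon> * s0 ^ Suc k) powr \<tau> * s0 ^ k) + \<epsilon> * s0 ^ k"
        using 1 norm_triangle_sub[of "deriv g 0" "\<Sum>i\<le>l. (deriv ^^ Suc i) g z * (0 - z) ^ i / fact i"] by linarith
      then show False using \<epsilon>(3) d1 by linarith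
    qed
  qed
qed

subsection \<open>Rescaling\<close>

lemma vanishes_order_compose_linear:
  assumes v: "vanishes_order m f (\<rho> * z + w)"
  shows "vanishes_order m (\<lambda>x. c * f (\<rho> * x + w)) z"
proof -
  obtain u where u: "u analytic_on {\<rho> * z + w}"
    and ev: "\<forall>\<^sub>F x in nhds (\<rho> * z + w). f x = (x - (\<rho> * z + w)) ^ m * u x"
    using v by (auto simp: vanishes_order_def)
  have "((\<lambda>x. \<rho> * x + w) \<longlongrightarrow> \<rho> * z + w) (nhds z)"
    by (intro tendsto_intros filterlim_ident)
  then have "\<forall>\<^sub>F x in nhds z. f (\<rho> * x + w) = ((\<rho> * x + w) - (\<rho> * z + w)) ^ m * u (\<rho> * x + w)"
    using ev by (rule eventually_compose_filterlim[rotated])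
  then have "\<forall>\<^sub>F x in nhds z. c * f (\<rho> * x + w) = (x - z) ^ m * (c * \<rho> ^ m * u (\<rho> * x + w))"
  proof eventually_elim
    case (elim x)
    have "(\<rho> * x + w) - (\<rho> * z + w) = \<rho> * (x - z)" by (simp add: algebra_simps)
    then show ?case using elim by (simp add: power_mult_distrib)
  qed
  moreover have "(\<lambda>x. u (\<rho> * x + w)) analytic_on {z}"
    by (rule analytic_on_compose_gen[of _ "{z}" u "{\<rho> * z + w}", unfolded o_def]) (use u in \<open>auto intro!: analytic_intros\<close>)
  then have "(\<lambda>x. c * \<rho> ^ m * u (\<rho> * x + w)) analytic_on {z}" by (intro analytic_intros)
  ultimately show ?thesis unfolding vanishes_order_def by blast
qed

text \<open>The factor \<rho>^(-k) is the one that leaves values of the k-th derivative unchanged,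
  so its 1-points and their multiplicities carry over.\<close>

lemma admissible_rescale:
  fixes \<rho> :: real and w :: complex
  assumes f: "admissible k m n S f" and S: "open S" and T: "open T" and \<rho>: "\<rho> \<noteq> 0"
    and sub: "\<And>x. x \<in> T \<Longrightarrow> of_real \<rho> * x + w \<in> S"
  shows "admissible k m n T (\<lambda>x. inverse (of_real \<rho> ^ k) * f (of_real \<rho> * x + w))"
    and "\<And>x. x \<in> T \<Longrightarrow> deriv (\<lambda>x. inverse (of_real \<rho> ^ k) * f (of_real \<rho> * x + w)) x =
            inverse (of_real \<rho> ^ k) * of_real \<rho> * deriv f (of_real \<rho> * x + w)"
proof -
  define c :: complex where "c = inverse (of_real \<rho> ^ k)"
  define g where "g = (\<lambda>x. f (of_real \<rho> * x + w))"
  have hol: "f holomorphic_on S" using f by (simp add: admissible_def)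
  have g: "g holomorphic_on T"
    unfolding g_def
    by (rule holomorphic_on_compose_gen[OF _ hol, unfolded o_def]) (use sub in \<open>auto intro!: holomorphic_intros\<close>)
  have dg: "(deriv ^^ j) (\<lambda>x. c * g x) x = c * of_real \<rho> ^ j * (deriv ^^ j) f (of_real \<rho> * x + w)" if "x \<in> T" for j x
    using higher_deriv_cmult[OF g that T] higher_deriv_compose_linear'[OF hol T S that sub, of j]
    by (simp add: g_def)
  have dk: "(deriv ^^ k) (\<lambda>x. c * g x) x = (deriv ^^ k) f (of_real \<rho> * x + w)" if "x \<in> T" for x
    using dg[OF that, of k] \<rho> by (simp add: c_def)
  show "\<And>x. x \<in> T \<Longrightarrow> deriv (\<lambda>x. inverse (of_real \<rho> ^ k) * f (of_real \<rho> * x + w)) x =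
            inverse (of_real \<rho> ^ k) * of_real \<rho> * deriv f (of_real \<rho> * x + w)"
    using dg[of _ 1] by (simp add: c_def g_def)
  have "admissible k m n T (\<lambda>x. c * g x)"
    unfolding admissible_def
  proof (intro conjI ballI impI)
    show "(\<lambda>x. c * g x) holomorphic_on T" using g by (intro holomorphic_intros)
    fix x assume x: "x \<in> T"
    { assume "c * g x = 0"
      then have "f (of_real \<rho> * x + w) = 0" using \<rho> by (simp add: c_def g_def)
      then have "vanishes_order m f (of_real \<rho> * x + w)" using f sub[OF x] by (simp add: admissible_def)
      then show "vanishes_order m (\<lambda>x. c * g x) x"
        unfolding g_def by (rule vanishes_order_compose_linear) }
    assume "(deriv ^^ k) (\<lambda>x. c * g x) x = 1"
    then have "(deriv ^^ k) f (of_real \<rho> * x + w) = 1" using dk[OF x] by simp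
    then have "vanishes_order n (\<lambda>y. (deriv ^^ k) f y - 1) (of_real \<rho> * x + w)"
      using f sub[OF x] by (simp add: admissible_def)
    then have "vanishes_order n (\<lambda>x. 1 * ((deriv ^^ k) f (of_real \<rho> * x + w) - 1)) x"
      by (rule vanishes_order_compose_linear)
    then obtain u where u: "u analytic_on {x}"
      "\<forall>\<^sub>F y in nhds x. 1 * ((deriv ^^ k) f (of_real \<rho> * y + w) - 1) = (y - x) ^ n * u y"
      unfolding vanishes_order_def by blast
    have "\<forall>\<^sub>F y in nhds x. (deriv ^^ k) (\<lambda>x. c * g x) y - 1 = (y - x) ^ n * u y"
      using u(2) eventually_nhds_in_open[OF T x] by eventually_elim (use dk in simp)
    then show "vanishes_order n (\<lambda>y. (deriv ^^ k) (\<lambda>x. c * g x) y - 1) x"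
      unfolding vanishes_order_def using u(1) by blast
  qed
  then show "admissible k m n T (\<lambda>x. inverse (of_real \<rho> ^ k) * f (of_real \<rho> * x + w))"
    by (simp add: c_def g_def)
qed

text \<open>For a fixed \<open>f\<close> the blow-up cannot happen at arbitrarily small scales,
  although f / \<rho>^k may be huge. Zeros of order \<open>m\<close> give |f'| \<le> C1 |f| powr
  \<tau>. With y = |f| / \<rho>^k this makes \<rho> |f'| / \<rho>^k at most C1 \<rho> powr (1 - k (1
  - \<tau>)) times y powr \<tau>, and the exponent of \<rho> is positive because k < m allows 1 -
  \<tau> < 1 / k.\<close>

lemma small_scales_below_growth:
  assumes k: "0 < k" "k < m" and adm: "admissible k m n (ball a (2 * r)) f" and r: "0 < r"
  shows "\<exists>\<rho>0>0. \<forall>z\<in>ball a r. \<forall>\<rho>. 0 < \<rho> \<and> \<rho> < \<rho>0 \<longrightarrow> \<rho> * cmod (deriv f z) < \<rho> ^ k * growth (cmod (f z) / \<rho> ^ k)"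
proof -
  have hol: "f holomorphic_on ball a (2 * r)" using adm by (simp add: admissible_def)
  have "compact (f ` cball a (3 * r / 2))"
    using r by (intro compact_continuous_image holomorphic_on_imp_continuous_on holomorphic_on_subset[OF hol]) auto
  then have "bounded (f ` cball a (3 * r / 2))" by (rule compact_imp_bounded)
  then obtain K0 where K0: "0 < K0" "\<And>x. x \<in> f ` cball a (3 * r / 2) \<Longrightarrow> cmod x \<le> K0"
    unfolding bounded_pos by auto
  define K where "K = K0 + 1"
  have K: "0 < K" using K0 by (simp add: K_def)
  have fK: "cmod (f w) < K" if "w \<in> cball a (3 * r / 2)" for w
    using K0(2)[of "f w"] that by (auto simp: K_def)
  \<comment> \<open>This puts 1 - \<tau> = 1 / m + \<eta> halfway between 1 / m and 1 / k.\<close>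
  define \<eta> where "\<eta> = (1 / real k - 1 / real m) / 2"
  have \<eta>0: "0 < \<eta>" using k by (simp add: \<eta>_def frac_less2)
  have k1: "1 / real k \<le> 1" using k by simp
  have m0: "0 < 1 / real m" using k by simp
  define \<tau> where "\<tau> = 1 - 1 / real m - \<eta>"
  have mk: "1 / real m < 1 / real k" using k by (simp add: frac_less2)
  have "(p - q) / 2 \<le> 1 \<and> 0 \<le> 1 - q - (p - q) / 2 \<and> 1 - q - (p - q) / 2 \<le> 1 \<and> 1 - (1 - q - (p - q) / 2) < p"
    if "p \<le> 1" "0 < q" "q < p" for p q :: real
    using that by (auto simp: field_simps)
  from this[OF k1 m0 mk] have \<eta>1: "\<eta> \<le> 1" and \<tau>: "0 \<le> \<tau>" "\<tau> \<le> 1" and \<tau>k: "1 - \<tau> < 1 / real k"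
    by (auto simp only: \<tau>_def \<eta>_def)
  have "real k * (1 - \<tau>) < 1"
  proof -
    have "real k * (1 - \<tau>) < real k * (1 / real k)" using k \<tau>k by (intro mult_strict_left_mono) auto
    then show ?thesis using k by simp
  qed
  then have e: "0 < 1 - real k * (1 - \<tau>)" (is "0 < ?e") by simp
  obtain C where C: "C > 0" and bd: "\<And>f z K. f holomorphic_on ball z (r / 2) \<Longrightarrow> (\<And>w. w \<in> ball z (r / 2) \<Longrightarrow> cmod (f w) < K) \<Longrightarrow>
       (\<And>w. w \<in> ball z (r / 2) \<Longrightarrow> f w = 0 \<Longrightarrow> vanishes_order m f w) \<Longrightarrow>
       cmod ((deriv ^^ 1) f z) \<le> C * K * (cmod (f z) / K) powr (1 - real 1 / real m - \<eta>)"
    using deriv_bound_of_zero_order[of 1 m \<eta> "r / 2"] k \<eta>0 \<eta>1 r by auto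
  define C1 where "C1 = C * K powr (1 - \<tau>)"
  have C1: "0 < C1" using C K by (simp add: C1_def)
  have der: "cmod (deriv f z) \<le> C1 * cmod (f z) powr \<tau>" if z: "z \<in> ball a r" for z
  proof -
    have sub: "w \<in> cball a (3 * r / 2)" "w \<in> ball a (2 * r)" if "w \<in> ball z (r / 2)" for w
      using that z dist_triangle[of a w z] r by auto
    have "cmod ((deriv ^^ 1) f z) \<le> C * K * (cmod (f z) / K) powr (1 - real 1 / real m - \<eta>)"
      by (rule bd) (use sub fK adm in \<open>auto simp: admissible_def intro: holomorphic_on_subset[OF hol]\<close>)
    also have "\<dots> = C1 * cmod (f z) powr \<tau>"
      using mult_powr_divide_le[OF K, of "cmod (f z)" \<tau>] by (simp add: C1_def \<tau>_def mult.assoc)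
    finally show ?thesis by simp
  qed
  \<comment> \<open>The scale at which \<open>C1 * \<rho> powr ?e\<close> equals 1.\<close>
  define \<rho>0 where "\<rho>0 = (1 / C1) powr (1 / ?e)"
  show ?thesis
  proof (intro exI[of _ \<rho>0] conjI ballI allI impI; (elim conjE)?)
    show "0 < \<rho>0" using C1 by (simp add: \<rho>0_def)
    fix z \<rho> assume z: "z \<in> ball a r" and \<rho>: "0 < \<rho>" "\<rho> < \<rho>0"
    define y where "y = cmod (f z) / \<rho> ^ k"
    have y: "0 \<le> y" using \<rho> by (simp add: y_def)
    have fy: "cmod (f z) = \<rho> ^ k * y" using \<rho> by (simp add: y_def)
    have "\<rho> powr ?e < \<rho>0 powr ?e" using \<rho> e by (intro powr_less_mono2) auto
    also have "\<dots> = 1 / C1" using C1 e by (simp add: \<rho>0_def powr_powr)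
    finally have small: "C1 * \<rho> powr ?e < 1" using C1 by (simp add: field_simps)
    have "y powr \<tau> \<le> (1 + y) powr \<tau>" using y \<tau> by (intro powr_mono2) auto
    also have "\<dots> \<le> (1 + y) powr 1" using y \<tau> by (intro powr_mono) auto
    finally have y1: "y powr \<tau> \<le> 1 + y" using y by simp
    have \<rho>k: "\<rho> ^ k = \<rho> powr real k" using \<rho> by (simp add: powr_realpow)
    have "\<rho> * cmod (deriv f z) \<le> \<rho> * (C1 * cmod (f z) powr \<tau>)"
      using der[OF z] \<rho> by (intro mult_left_mono) auto
    also have "\<dots> = C1 * (\<rho> powr 1 * \<rho> powr (real k * \<tau>)) * y powr \<tau>"
      unfolding fy using \<rho> y by (simp add: powr_mult \<rho>k powr_powr)
    also have "\<rho> powr 1 * \<rho> powr (real k * \<tau>) = \<rho> powr ?e * \<rho> ^ k"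
      unfolding \<rho>k powr_add[symmetric] by (simp add: algebra_simps)
    also have "C1 * (\<rho> powr ?e * \<rho> ^ k) * y powr \<tau> \<le> C1 * (\<rho> powr ?e * \<rho> ^ k) * (1 + y)"
      using y1 C1 \<rho> by (intro mult_left_mono) auto
    also have "\<dots> = (C1 * \<rho> powr ?e) * (\<rho> ^ k * (1 + y))" by simp
    also have "\<dots> < 1 * (\<rho> ^ k * (1 + y))" using small \<rho> y by (intro mult_strict_right_mono) auto
    also have "\<dots> \<le> \<rho> ^ k * growth y" using growth_ge[OF y] \<rho> by simp
    finally show "\<rho> * cmod (deriv f z) < \<rho> ^ k * growth (cmod (f z) / \<rho> ^ k)" by (simp add: y_def)
  qed
qed

text \<open>Call (z, \<rho>) bad if the function rescaled at (z, \<rho>) satisfies growth |g(0)|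
  \<le> |g'(0)|. If a bad pair had (r - dist a z) / \<rho> > 2 R, a nearly maximal one would rescale
  to a function tame on the disc of radius \<open>R\<close>, against
  \<open>tame_deriv_less_growth\<close>. So one fixed small scale is never bad on the half-size
  ball, and undoing the rescaling at that scale gives the bound.\<close>

lemma uniform_growth_bound:
  assumes pos: "k > 0" "m > 0" "n > 0" and less: "(real k + 1) / real m + 1 / real n < 1" and r: "0 < r"
  shows "\<exists>C>0. \<forall>a f. admissible k m n (ball a (2 * r)) f \<longrightarrow>
           (\<forall>z\<in>ball a (r / 2). cmod (deriv f z) \<le> C * growth (cmod (f z)))"
proof -
  \<comment> \<open>The factor lost between the scales \<open>\<rho>1 / 4\<close> and
    \<open>\<rho>1\<close>: 4 from the derivative and the rest from \<open>growth_scale\<close> with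
    c = 4^k.\<close>
  define C0 where "C0 = 4 * (1 + 2 * ln (4 ^ k :: real))"
  have "0 < 4 * (1 + 2 * l)" if "0 \<le> l" for l :: real using that by simp
  moreover have "0 \<le> ln (4 ^ k :: real)" by (rule ln_ge_zero) simp
  ultimately have C0: "0 < C0" unfolding C0_def by blast
  obtain R where R: "0 < R" and "\<forall>g. tame C0 k m n (ball 0 R) g \<longrightarrow> cmod (deriv g 0) < growth (cmod (g 0))"
    using tame_deriv_less_growth[OF pos less C0] by blast
  then have noblow: "cmod (deriv g 0) < growth (cmod (g 0))" if "tame C0 k m n (ball 0 R) g" for g
    using that by blast
  have km: "k < m"
  proof -
    have "0 \<le> 1 / real n" by simp
    then have "(real k + 1) / real m < 1" using less by linarith
    then show ?thesis using pos by (simp add: field_simps)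
  qed
  have key: "r - dist a z \<le> 2 * R * \<rho>"
    if adm: "admissible k m n (ball a (2 * r)) f" and z: "z \<in> ball a r" and \<rho>: "0 < \<rho>"
      and bad: "\<rho> ^ k * growth (cmod (f z) / \<rho> ^ k) \<le> \<rho> * cmod (deriv f z)" for a f z \<rho>
  proof (rule ccontr)
    \<comment> \<open>Choosing \<open>(z1, \<rho>1)\<close> with ratio above \<open>Sup V / 2\<close> excludes scales below \<open>\<rho>1 / 4\<close> at all points near \<open>z1\<close>.\<close>
    define V where "V = {(r - dist a z) / \<rho> |z \<rho>. z \<in> ball a r \<and> 0 < \<rho> \<and>
       \<rho> ^ k * growth (cmod (f z) / \<rho> ^ k) \<le> \<rho> * cmod (deriv f z)}"
    have inV: "(r - dist a z) / \<rho> \<in> V" if "z \<in> ball a r" "0 < \<rho>" "\<rho> ^ k * growth (cmod (f z) / \<rho> ^ k) \<le> \<rho> * cmod (deriv f z)" for z \<rho>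
      using that by (auto simp: V_def)
    \<comment> \<open>For the single function \<open>f\<close>, bad scales are bounded below; hence
      \<open>V\<close> is bounded and its supremum is meaningful.\<close>
    obtain \<rho>0 where \<rho>0: "0 < \<rho>0" "\<forall>z\<in>ball a r. \<forall>\<rho>. 0 < \<rho> \<and> \<rho> < \<rho>0 \<longrightarrow> \<rho> * cmod (deriv f z) < \<rho> ^ k * growth (cmod (f z) / \<rho> ^ k)"
      using small_scales_below_growth[OF pos(1) km adm r] by blast
    have bdd: "bdd_above V"
    proof (rule bdd_aboveI)
      fix v assume "v \<in> V"
      then obtain z \<rho> where v: "v = (r - dist a z) / \<rho>" "z \<in> ball a r" "0 < \<rho>"
         "\<rho> ^ k * growth (cmod (f z) / \<rho> ^ k) \<le> \<rho> * cmod (deriv f z)" by (auto simp: V_def)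
      then have "\<rho>0 \<le> \<rho>" using \<rho>0(2)[rule_format, of z \<rho>] by (meson not_le)
      then show "v \<le> r / \<rho>0" unfolding v(1) using \<rho>0(1) v(2,3) r by (intro frac_le) auto
    qed
    assume "\<not> r - dist a z \<le> 2 * R * \<rho>"
    then have big: "2 * R < (r - dist a z) / \<rho>" using \<rho> by (simp add: field_simps)
    also have "\<dots> \<le> Sup V" using inV[OF z \<rho> bad] bdd by (rule cSup_upper)
    finally have "2 * R < Sup V" .
    then have "max (2 * R) (Sup V / 2) < Sup V" using R by auto
    moreover have "V \<noteq> {}" using inV[OF z \<rho> bad] by auto
    ultimately obtain v where "v \<in> V" "max (2 * R) (Sup V / 2) < v" using less_cSup_iff[OF _ bdd] by blast
    then obtain z1 \<rho>1 where v: "2 * R < (r - dist a z1) / \<rho>1" "Sup V / 2 < (r - dist a z1) / \<rho>1" "z1 \<in> ball a r" "0 < \<rho>1"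
         "\<rho>1 ^ k * growth (cmod (f z1) / \<rho>1 ^ k) \<le> \<rho>1 * cmod (deriv f z1)" by (auto simp: V_def)
    define d where "d = r - dist a z1"
    have d: "2 * R * \<rho>1 < d" "Sup V * \<rho>1 < 2 * d" using v(1,2,4) by (simp_all add: d_def field_simps)
    have ok: "\<rho>1 * cmod (deriv f w) / \<rho>1 ^ k \<le> C0 * growth (cmod (f w) / \<rho>1 ^ k)" if w: "w \<in> ball z1 (d / 2)" for w
    proof -
      have "dist a w \<le> dist a z1 + dist z1 w" by (rule dist_triangle)
      then have dw: "d / 2 < r - dist a w" using w by (simp add: d_def)
      then have wr: "w \<in> ball a r" using d(1) mult_pos_pos[OF R v(4)] by simp
      have "\<not> (\<rho>1 / 4) ^ k * growth (cmod (f w) / (\<rho>1 / 4) ^ k) \<le> (\<rho>1 / 4) * cmod (deriv f w)"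
      proof
        assume "(\<rho>1 / 4) ^ k * growth (cmod (f w) / (\<rho>1 / 4) ^ k) \<le> (\<rho>1 / 4) * cmod (deriv f w)"
        then have "(r - dist a w) / (\<rho>1 / 4) \<le> Sup V"
          using inV[OF wr, of "\<rho>1 / 4"] v(4) bdd by (intro cSup_upper) auto
        then have le: "4 * (r - dist a w) \<le> Sup V * \<rho>1" using v(4) by (simp add: field_simps)
        have "2 * d < 4 * (r - dist a w)" using dw by simp
        also note le
        also note d(2)
        finally show False .
      qed
      then have "\<rho>1 * cmod (deriv f w) < 4 * ((\<rho>1 / 4) ^ k * growth (cmod (f w) / (\<rho>1 / 4) ^ k))" by simp
      also have "cmod (f w) / (\<rho>1 / 4) ^ k = 4 ^ k * (cmod (f w) / \<rho>1 ^ k)" by (simp add: power_divide)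
      also have "4 * ((\<rho>1 / 4) ^ k * growth (4 ^ k * (cmod (f w) / \<rho>1 ^ k))) \<le>
         4 * ((\<rho>1 / 4) ^ k * (4 ^ k * (1 + 2 * ln (4 ^ k)) * growth (cmod (f w) / \<rho>1 ^ k)))"
        using v(4) by (intro mult_left_mono growth_scale) auto
      also have "\<dots> = \<rho>1 ^ k * (C0 * growth (cmod (f w) / \<rho>1 ^ k))" by (simp add: C0_def power_divide)
      finally show ?thesis using v(4) by (simp add: field_simps)
    qed
    define g where "g = (\<lambda>x. inverse (of_real \<rho>1 ^ k) * f (of_real \<rho>1 * x + z1))"
    have sub: "of_real \<rho>1 * x + z1 \<in> ball z1 (d / 2)" if "x \<in> ball 0 R" for x
    proof -
      have "\<rho>1 * cmod x \<le> \<rho>1 * R" using that v(4) by (intro mult_left_mono) auto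
      also have "\<rho>1 * R = 2 * R * \<rho>1 / 2" by simp
      also have "\<dots> < d / 2" using d(1) by (rule divide_strict_right_mono) simp
      finally have "cmod (of_real \<rho>1 * x) < d / 2" using v(4) by (simp add: norm_mult)
      then show ?thesis by (simp add: dist_norm)
    qed
    have sub2: "ball z1 (d / 2) \<subseteq> ball a (2 * r)"
    proof
      fix w assume "w \<in> ball z1 (d / 2)"
      then show "w \<in> ball a (2 * r)" using dist_triangle[of a w z1] v(3) r by (simp add: d_def)
    qed
    have \<rho>1: "\<rho>1 \<noteq> 0" using v(4) by simp
    have sub3: "of_real \<rho>1 * x + z1 \<in> ball a (2 * r)" if "x \<in> ball 0 R" for x using sub[OF that] sub2 by blast
    have adm_g: "admissible k m n (ball 0 R) g"
      unfolding g_def by (rule admissible_rescale(1)[OF adm open_ball open_ball \<rho>1]) (rule sub3)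
    have dg: "deriv g x = inverse (of_real \<rho>1 ^ k) * of_real \<rho>1 * deriv f (of_real \<rho>1 * x + z1)"
      if "x \<in> ball 0 R" for x
      unfolding g_def by (rule admissible_rescale(2)[OF adm open_ball open_ball \<rho>1 _ that]) (rule sub3)
    have ng: "cmod (g x) = cmod (f (of_real \<rho>1 * x + z1)) / \<rho>1 ^ k" for x
      using v(4) by (simp add: g_def norm_mult norm_inverse norm_power divide_inverse mult.commute)
    have ndg: "cmod (deriv g x) = \<rho>1 * cmod (deriv f (of_real \<rho>1 * x + z1)) / \<rho>1 ^ k" if "x \<in> ball 0 R" for x
      using v(4) by (simp add: dg[OF that] norm_mult norm_inverse norm_power divide_inverse mult_ac)
    have "tame C0 k m n (ball 0 R) g"
      unfolding tame_def
    proof (intro conjI adm_g ballI)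
      fix x assume x: "x \<in> ball (0::complex) R"
      show "cmod (deriv g x) \<le> C0 * growth (cmod (g x))" using ok[OF sub[OF x]] by (simp add: ng ndg[OF x])
    qed
    then have "cmod (deriv g 0) < growth (cmod (g 0))" by (rule noblow)
    then have "\<rho>1 * cmod (deriv f z1) / \<rho>1 ^ k < growth (cmod (f z1) / \<rho>1 ^ k)" using R by (simp add: ng ndg)
    then show False using v(4,5) by (simp add: field_simps)
  qed
  \<comment> \<open>On the ball of radius r / 2 one has r - dist a z > r / 2 \<ge> 4 R \<rho>, so
    \<open>key\<close> excludes this scale at every point there.\<close>
  define \<rho> where "\<rho> = min 1 (r / (8 * R))"
  have \<rho>: "0 < \<rho>" "\<rho> \<le> 1" "8 * R * \<rho> \<le> r" using R r by (auto simp: \<rho>_def field_simps min_def)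
  define c where "c = 1 / \<rho> ^ k"
  have c: "1 \<le> c" using \<rho> by (simp add: c_def power_le_one)
  define C where "C = \<rho> ^ k * (c * (1 + 2 * ln c)) / \<rho>"
  have lnc: "0 < 1 + 2 * ln c" using c by (intro add_pos_nonneg mult_nonneg_nonneg ln_ge_zero) auto
  have C: "0 < C" unfolding C_def using \<rho> c lnc by (intro divide_pos_pos mult_pos_pos) auto
  show ?thesis
  proof (intro exI[of _ C] conjI allI impI ballI C)
    fix a :: complex and f z assume adm: "admissible k m n (ball a (2 * r)) f" and z: "z \<in> ball a (r / 2)"
    have zr: "z \<in> ball a r" using z r by simp
    have "0 < R * \<rho>" using R \<rho> by simp
    then have "2 * R * \<rho> < r - dist a z" using z \<rho>(3) by simp
    then have "\<rho> * cmod (deriv f z) < \<rho> ^ k * growth (cmod (f z) / \<rho> ^ k)"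
      using key[OF adm zr \<rho>(1)] by force
    also have "\<dots> = \<rho> ^ k * growth (c * cmod (f z))" by (simp add: c_def)
    also have "\<dots> \<le> \<rho> ^ k * (c * (1 + 2 * ln c) * growth (cmod (f z)))"
      using \<rho> c by (intro mult_left_mono growth_scale) auto
    finally show "cmod (deriv f z) \<le> C * growth (cmod (f z))"
      using \<rho> by (simp add: C_def field_simps)
  qed
qed

subsection \<open>From local bounds to normality\<close>

lemma chordal_le_dist: "chordal (Some z) (Some w) \<le> 2 * dist z w"
proof -
  have "1 * 1 \<le> sqrt (1 + (cmod z)\<^sup>2) * sqrt (1 + (cmod w)\<^sup>2)" by (intro mult_mono) auto
  then have "2 * cmod (z - w) / (sqrt (1 + (cmod z)\<^sup>2) * sqrt (1 + (cmod w)\<^sup>2)) \<le> 2 * cmod (z - w) / 1"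
    by (intro divide_left_mono) auto
  then show ?thesis by (simp add: dist_norm)
qed

lemma chordal_infinity_less:
  assumes "0 < \<epsilon>" "2 / \<epsilon> < cmod z"
  shows "chordal (Some z) None < \<epsilon>"
proof -
  have "cmod z \<le> sqrt (1 + (cmod z)\<^sup>2)" by (rule real_le_rsqrt) simp
  then have "2 / \<epsilon> < sqrt (1 + (cmod z)\<^sup>2)" using assms(2) by linarith
  moreover have "0 < sqrt (1 + (cmod z)\<^sup>2)" by (simp add: add_pos_nonneg)
  ultimately show ?thesis using assms(1) by (simp add: field_simps)
qed

text \<open>The local hypothesis makes both boundedness of a sequence at a point and divergence to
  infinity there locally constant properties, so connectedness spreads them over D. A sequence
  bounded at \<open>a0\<close> is therefore locally bounded and Montel's theorem applies; otherwise
  a subsequence diverging at \<open>a0\<close> diverges locally uniformly.\<close>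

lemma normal_family_of_local_bound:
  assumes D: "open D" "connected D" "D \<noteq> {}"
    and hol: "\<And>f. f \<in> F \<Longrightarrow> f holomorphic_on D"
    and loc: "\<And>a. a \<in> D \<Longrightarrow> \<exists>r>0. ball a r \<subseteq> D \<and>
       (\<forall>T. \<exists>M. \<forall>f\<in>F. \<forall>z\<in>ball a r. \<forall>w\<in>ball a r. cmod (f z) \<le> T \<longrightarrow> cmod (f w) \<le> M)"
  shows "normal_family D F"
  unfolding normal_family_def
proof (intro allI impI)
  fix s :: "nat \<Rightarrow> complex \<Rightarrow> complex" assume sF: "range s \<subseteq> F"
  then have sF': "s j \<in> F" for j by auto
  obtain a0 where a0: "a0 \<in> D" using D(3) by blast
  show "\<exists>(r :: nat \<Rightarrow> nat) g. strict_mono r \<and>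
           ((\<exists>h. h holomorphic_on D \<and> g = (\<lambda>z. Some (h z))) \<or> g = (\<lambda>z. None)) \<and>
           (\<forall>K. compact K \<and> K \<subseteq> D \<longrightarrow> spherically_uniform_limit K (\<lambda>j. s (r j)) g)"
  proof (cases "bounded (range (\<lambda>j. s j a0))")
    case True
    have bdd: "bounded (range (\<lambda>j. s j z))" if z: "z \<in> D" for z
    proof -
      have "bounded (range (\<lambda>j. s j a0)) = bounded (range (\<lambda>j. s j z))"
      proof (rule connected_equivalence_relation[OF D(2) a0 z])
        fix a assume "a \<in> D"
        then obtain r where r: "r > 0" "ball a r \<subseteq> D"
          and M: "\<And>T. \<exists>M. \<forall>f\<in>F. \<forall>z\<in>ball a r. \<forall>w\<in>ball a r. cmod (f z) \<le> T \<longrightarrow> cmod (f w) \<le> M"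
          using loc by blast
        have imp: "bounded (range (\<lambda>j. s j w))"
          if b: "bounded (range (\<lambda>j. s j z))" and zw: "z \<in> ball a r" "w \<in> ball a r" for z w
        proof -
          obtain T where "\<forall>x\<in>range (\<lambda>j. s j z). cmod x \<le> T" using b unfolding bounded_iff by blast
          then have T: "cmod (s j z) \<le> T" for j by blast
          obtain M where "\<forall>f\<in>F. \<forall>z\<in>ball a r. \<forall>w\<in>ball a r. cmod (f z) \<le> T \<longrightarrow> cmod (f w) \<le> M" using M by blast
          then have "cmod (s j w) \<le> M" for j using T sF' zw by blast
          then show ?thesis by (auto simp: bounded_iff)
        qed
        show "\<exists>T. openin (top_of_set D) T \<and> a \<in> T \<and> (\<forall>x\<in>T. bounded (range (\<lambda>j. s j a)) = bounded (range (\<lambda>j. s j x)))"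
        proof (intro exI[of _ "ball a r"] conjI ballI)
          show "openin (top_of_set D) (ball a r)" using r by (simp add: open_subset)
          show "a \<in> ball a r" using r by simp
          show "bounded (range (\<lambda>j. s j a)) = bounded (range (\<lambda>j. s j x))" if "x \<in> ball a r" for x
            using imp[of a x] imp[of x a] that r by auto
        qed
      qed auto
      then show ?thesis using True by simp
    qed
    have bdK: "\<exists>B. \<forall>h\<in>range s. \<forall>z\<in>K. cmod (h z) \<le> B" if K: "compact K" "K \<subseteq> D" for K
    proof -
      have "\<exists>r M. a \<in> K \<longrightarrow> 0 < r \<and> (\<forall>j. \<forall>w\<in>ball a r. cmod (s j w) \<le> M)" for a
      proof (cases "a \<in> K")
        case True
        then have aD: "a \<in> D" using K by blast
        obtain r where r: "r > 0"
          and M: "\<And>T. \<exists>M. \<forall>f\<in>F. \<forall>z\<in>ball a r. \<forall>w\<in>ball a r. cmod (f z) \<le> T \<longrightarrow> cmod (f w) \<le> M"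
          using loc[OF aD] by blast
        obtain T where "\<forall>x\<in>range (\<lambda>j. s j a). cmod x \<le> T" using bdd[OF aD] unfolding bounded_iff by blast
        then have T: "cmod (s j a) \<le> T" for j by blast
        obtain M where "\<forall>f\<in>F. \<forall>z\<in>ball a r. \<forall>w\<in>ball a r. cmod (f z) \<le> T \<longrightarrow> cmod (f w) \<le> M" using M by blast
        moreover have "a \<in> ball a r" using r by simp
        ultimately have "\<forall>j. \<forall>w\<in>ball a r. cmod (s j w) \<le> M" using T sF' by blast
        then show ?thesis using r by blast
      qed auto
      then obtain r M where rM: "\<And>a. a \<in> K \<Longrightarrow> 0 < r a" "\<And>a j w. a \<in> K \<Longrightarrow> w \<in> ball a (r a) \<Longrightarrow> cmod (s j w) \<le> M a"
        by metis
      have cover: "K \<subseteq> (\<Union>a\<in>K. ball a (r a))" using rM(1) by force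
      obtain K' where K': "K' \<subseteq> K" "finite K'" "K \<subseteq> (\<Union>a\<in>K'. ball a (r a))"
        by (rule compactE_image[OF K(1), of K "\<lambda>a. ball a (r a)", OF open_ball cover])
      have "cmod (s j z) \<le> (\<Sum>a\<in>K'. \<bar>M a\<bar>)" if z: "z \<in> K" for j z
      proof -
        obtain a where a: "a \<in> K'" "z \<in> ball a (r a)" using K' z by blast
        have "cmod (s j z) \<le> \<bar>M a\<bar>" using rM(2)[of a z j] a K' by force
        also have "\<dots> \<le> (\<Sum>a\<in>K'. \<bar>M a\<bar>)" using a K' by (intro member_le_sum) auto
        finally show ?thesis .
      qed
      then show ?thesis by blast
    qed
    obtain h r where h: "h holomorphic_on D" "strict_mono (r :: nat \<Rightarrow> nat)"
      and lim: "\<And>K. compact K \<Longrightarrow> K \<subseteq> D \<Longrightarrow> uniform_limit K (s \<circ> r) h sequentially"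
    proof (rule Montel[OF D(1), of "range s" s])
      show "f holomorphic_on D" if "f \<in> range s" for f using hol sF that by blast
    qed (use bdK in auto)
    show ?thesis
    proof (intro exI[of _ r] exI[of _ "\<lambda>z. Some (h z)"] conjI allI impI)
      fix K assume "compact K \<and> K \<subseteq> D"
      then have ul: "uniform_limit K (s \<circ> r) h sequentially" using lim by blast
      show "spherically_uniform_limit K (\<lambda>j. s (r j)) (\<lambda>z. Some (h z))"
        unfolding spherically_uniform_limit_def
      proof (intro allI impI)
        fix \<epsilon> :: real assume "0 < \<epsilon>"
        then have "\<forall>\<^sub>F j in sequentially. \<forall>z\<in>K. dist ((s \<circ> r) j z) (h z) < \<epsilon> / 2"
          by (intro uniform_limitD[OF ul]) simp
        then show "\<forall>\<^sub>F j in sequentially. \<forall>z\<in>K. chordal (Some (s (r j) z)) (Some (h z)) < \<epsilon>"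
        proof eventually_elim
          case (elim j)
          show ?case
          proof
            fix z assume "z \<in> K"
            then have "2 * dist (s (r j) z) (h z) < \<epsilon>" using elim by auto
            then show "chordal (Some (s (r j) z)) (Some (h z)) < \<epsilon>"
              using chordal_le_dist[of "s (r j) z" "h z"] by linarith
          qed
        qed
      qed
    qed (use h in auto)
  next
    case False
    have ex: "\<exists>j>i. T < cmod (s j a0)" for i T
    proof (rule ccontr)
      assume "\<not> ?thesis"
      then have le: "cmod (s j a0) \<le> T" if "j > i" for j using that by force
      have "cmod (s j a0) \<le> max T (Max ((\<lambda>j. cmod (s j a0)) ` {..i}))" for j
        using le[of j] by (cases "j > i") (auto simp: le_max_iff_disj intro!: disjI2 Max_ge)
      then show False using False by (auto simp: bounded_iff)
    qed
    define r where "r = rec_nat (SOME j. 0 < cmod (s j a0)) (\<lambda>n i. SOME j. j > i \<and> real (Suc n) < cmod (s j a0))"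
    have rSuc: "r (Suc n) > r n \<and> real (Suc n) < cmod (s (r (Suc n)) a0)" for n
      using someI_ex[OF ex[of "r n" "real (Suc n)", unfolded Bex_def]] by (simp add: r_def)
    then have mono: "strict_mono r" by (simp add: strict_mono_Suc_iff)
    define t where "t = (\<lambda>j. s (r j))"
    have tF: "t j \<in> F" for j using sF' by (simp add: t_def)
    define R where "R = (\<lambda>z. \<forall>T. \<forall>\<^sub>F j in sequentially. T < cmod (t j z))"
    have "R a0"
      unfolding R_def
    proof
      fix T :: real
      have "T < cmod (t j a0)" if j: "j \<ge> Suc (nat \<lceil>T\<rceil>)" for j
      proof -
        obtain i where i: "j = Suc i" using j by (cases j) auto
        have "T \<le> real j" using j by linarith
        then show ?thesis using rSuc[of i] by (simp add: t_def i)
      qed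
      then show "\<forall>\<^sub>F j in sequentially. T < cmod (t j a0)" by (auto simp: eventually_sequentially)
    qed
    \<comment> \<open>The contrapositive of the local bound, with the two points exchanged: |f w|
      \<le> T would force |f z| \<le> M.\<close>
    have lift: "\<exists>M. \<forall>j. \<forall>w\<in>ball a r. M < cmod (t j z) \<longrightarrow> T < cmod (t j w)"
      if M: "\<forall>T. \<exists>M. \<forall>f\<in>F. \<forall>z\<in>ball a r. \<forall>w\<in>ball a r. cmod (f z) \<le> T \<longrightarrow> cmod (f w) \<le> M"
        and z: "z \<in> ball a r" for a r T z
    proof -
      obtain M where "\<forall>f\<in>F. \<forall>z\<in>ball a r. \<forall>w\<in>ball a r. cmod (f z) \<le> T \<longrightarrow> cmod (f w) \<le> M" using M by blast
      then have "M < cmod (t j z) \<longrightarrow> T < cmod (t j w)" if "w \<in> ball a r" for j w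
        using that z tF[of j] by (meson not_le)
      then show ?thesis by blast
    qed
    have RD: "R z" if z: "z \<in> D" for z
    proof -
      have "R a0 = R z"
      proof (rule connected_equivalence_relation[OF D(2) a0 z])
        fix a assume "a \<in> D"
        then obtain r where r: "r > 0" "ball a r \<subseteq> D"
          and M: "\<forall>T. \<exists>M. \<forall>f\<in>F. \<forall>z\<in>ball a r. \<forall>w\<in>ball a r. cmod (f z) \<le> T \<longrightarrow> cmod (f w) \<le> M"
          using loc by blast
        have imp: "R w" if Rz: "R z" and zw: "z \<in> ball a r" "w \<in> ball a r" for z w
          unfolding R_def
        proof
          fix T
          obtain M' where M': "\<forall>j. \<forall>w\<in>ball a r. M' < cmod (t j z) \<longrightarrow> T < cmod (t j w)"
            using lift[OF M zw(1)] by blast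
          have "\<forall>\<^sub>F j in sequentially. M' < cmod (t j z)" using Rz by (simp add: R_def)
          then show "\<forall>\<^sub>F j in sequentially. T < cmod (t j w)" by eventually_elim (use M' zw(2) in blast)
        qed
        show "\<exists>T. openin (top_of_set D) T \<and> a \<in> T \<and> (\<forall>x\<in>T. R a = R x)"
        proof (intro exI[of _ "ball a r"] conjI ballI)
          show "openin (top_of_set D) (ball a r)" using r by (simp add: open_subset)
          show "a \<in> ball a r" using r by simp
          show "R a = R x" if "x \<in> ball a r" for x
            using imp[of a x] imp[of x a] that r by auto
        qed
      qed auto
      then show ?thesis using \<open>R a0\<close> by simp
    qed
    have unif: "\<forall>\<^sub>F j in sequentially. \<forall>z\<in>K. T < cmod (t j z)" if K: "compact K" "K \<subseteq> D" for K T
    proof -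
      have "\<exists>r. a \<in> K \<longrightarrow> 0 < r \<and> (\<forall>\<^sub>F j in sequentially. \<forall>w\<in>ball a r. T < cmod (t j w))" for a
      proof (cases "a \<in> K")
        case True
        then have aD: "a \<in> D" using K by blast
        obtain r where r: "r > 0"
          and M: "\<forall>T. \<exists>M. \<forall>f\<in>F. \<forall>z\<in>ball a r. \<forall>w\<in>ball a r. cmod (f z) \<le> T \<longrightarrow> cmod (f w) \<le> M"
          using loc[OF aD] by blast
        obtain M' where M': "\<forall>j. \<forall>w\<in>ball a r. M' < cmod (t j a) \<longrightarrow> T < cmod (t j w)"
          using lift[OF M, of a] r by auto
        have "\<forall>\<^sub>F j in sequentially. M' < cmod (t j a)" using RD[OF aD] by (simp add: R_def)
        then have "\<forall>\<^sub>F j in sequentially. \<forall>w\<in>ball a r. T < cmod (t j w)" by eventually_elim (use M' in blast)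
        then show ?thesis using r by blast
      qed auto
      then obtain r where r: "\<And>a. a \<in> K \<Longrightarrow> 0 < r a"
        "\<And>a. a \<in> K \<Longrightarrow> \<forall>\<^sub>F j in sequentially. \<forall>w\<in>ball a (r a). T < cmod (t j w)"
        by metis
      have cover: "K \<subseteq> (\<Union>a\<in>K. ball a (r a))" using r(1) by force
      obtain K' where K': "K' \<subseteq> K" "finite K'" "K \<subseteq> (\<Union>a\<in>K'. ball a (r a))"
        by (rule compactE_image[OF K(1), of K "\<lambda>a. ball a (r a)", OF open_ball cover])
      have "\<forall>\<^sub>F j in sequentially. \<forall>a\<in>K'. \<forall>w\<in>ball a (r a). T < cmod (t j w)"
        using K' r(2) by (intro eventually_ball_finite) auto
      then show ?thesis by eventually_elim (use K' in blast)
    qed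
    show ?thesis
    proof (intro exI[of _ r] exI[of _ "\<lambda>z. None"] conjI allI impI)
      fix K assume K: "compact K \<and> K \<subseteq> D"
      show "spherically_uniform_limit K (\<lambda>j. s (r j)) (\<lambda>z. None)"
        unfolding spherically_uniform_limit_def
      proof (intro allI impI)
        fix \<epsilon> :: real assume \<epsilon>: "0 < \<epsilon>"
        have "\<forall>\<^sub>F j in sequentially. \<forall>z\<in>K. 2 / \<epsilon> < cmod (t j z)" using unif K by blast
        then show "\<forall>\<^sub>F j in sequentially. \<forall>z\<in>K. chordal (Some (s (r j) z)) None < \<epsilon>"
          by eventually_elim (use chordal_infinity_less[OF \<epsilon>] in \<open>auto simp: t_def simp del: chordal.simps\<close>)
      qed
    qed (use mono in auto)
  qed
qed

section \<open>From zero multiplicities to the theorem\<close>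

lemma vanishes_order_of_zero_multiplicity:
  assumes f: "f holomorphic_on D" and D: "open D" "z \<in> D" and mult: "enat m \<le> zero_multiplicity f z"
  shows "vanishes_order m f z"
proof (cases "\<forall>\<^sub>F w in nhds z. f w = 0")
  case True
  then have "\<forall>\<^sub>F w in nhds z. f w = (w - z) ^ m * 0" by eventually_elim simp
  then show ?thesis unfolding vanishes_order_def by (intro exI[of _ "\<lambda>_. 0"]) auto
next
  case False
  then have m: "m \<le> nat (zorder f z)" using mult by (simp add: zero_multiplicity_def)
  obtain r where r: "r > 0" "ball z r \<subseteq> D" using D by (auto simp: open_contains_ball)
  have "\<exists>w\<in>ball z r. f w \<noteq> 0"
  proof (rule ccontr)
    assume "\<not> ?thesis"
    moreover have "\<forall>\<^sub>F w in nhds z. w \<in> ball z r" using r by (intro eventually_nhds_in_open) auto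
    ultimately have "\<forall>\<^sub>F w in nhds z. f w = 0" by (auto elim: eventually_mono)
    with False show False by blast
  qed
  then obtain r' where r': "r' > 0" "zor_poly f z holomorphic_on cball z r'"
    "\<And>w. w \<in> cball z r' \<Longrightarrow> f w = zor_poly f z w * (w - z) ^ nat (zorder f z)"
    using zorder_exist_zero[of f "ball z r" z] holomorphic_on_subset[OF f r(2)] r by (auto split: if_splits)
  define u where "u = (\<lambda>w. zor_poly f z w * (w - z) ^ (nat (zorder f z) - m))"
  have "zor_poly f z analytic_on {z}"
    using r' by (auto simp: analytic_at intro!: exI[of _ "ball z r'"] holomorphic_on_subset[OF r'(2)])
  then have "u analytic_on {z}" unfolding u_def by (intro analytic_intros)
  moreover have "\<forall>\<^sub>F w in nhds z. w \<in> ball z r'" using r' by (intro eventually_nhds_in_open) auto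
  then have "\<forall>\<^sub>F w in nhds z. f w = (w - z) ^ m * u w"
  proof eventually_elim
    case (elim w)
    have "(w - z) ^ m * (w - z) ^ (nat (zorder f z) - m) = (w - z) ^ nat (zorder f z)"
      using m by (simp flip: power_add)
    then show ?case using r'(3)[of w] elim by (simp add: u_def mult.left_commute)
  qed
  ultimately show ?thesis unfolding vanishes_order_def by blast
qed

theorem corollary1p3:
  fixes F :: "(complex \<Rightarrow> complex) set" and D :: "complex set" and k m n :: nat
  assumes "open D" and "connected D" and "D \<noteq> {}"
    and "\<And>f. f \<in> F \<Longrightarrow> f holomorphic_on D"
    and "k > 0" and "m > 0" and "n > 0"
    and "(real k + 1) / real m + 1 / real n < 1"
    and "\<And>f z. f \<in> F \<Longrightarrow> z \<in> D \<Longrightarrow> f z = 0 \<Longrightarrow> enat m \<le> zero_multiplicity f z"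
    and "\<And>f z. f \<in> F \<Longrightarrow> z \<in> D \<Longrightarrow> (deriv ^^ k) f z - 1 = 0 \<Longrightarrow>
           enat n \<le> zero_multiplicity (\<lambda>w. (deriv ^^ k) f w - 1) z"
  shows "normal_family D F"
proof (rule normal_family_of_local_bound[OF assms(1-4)])
  have adm: "admissible k m n D f" if f: "f \<in> F" for f
    unfolding admissible_def
  proof (intro conjI ballI impI)
    show hol: "f holomorphic_on D" using assms(4) f .
    fix z assume z: "z \<in> D"
    show "vanishes_order m f z" if "f z = 0"
      using vanishes_order_of_zero_multiplicity[OF hol assms(1) z] assms(9)[OF f z that] .
    have "(\<lambda>w. (deriv ^^ k) f w - 1) holomorphic_on D"
      using holomorphic_higher_deriv[OF hol assms(1)] by (intro holomorphic_on_diff holomorphic_on_const)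
    then show "vanishes_order n (\<lambda>w. (deriv ^^ k) f w - 1) z" if "(deriv ^^ k) f z = 1"
      using vanishes_order_of_zero_multiplicity[OF _ assms(1) z] assms(10)[OF f z] that by simp
  qed
  fix a assume "a \<in> D"
  then obtain r0 where r0: "r0 > 0" "ball a r0 \<subseteq> D" using assms(1) by (auto simp: open_contains_ball)
  define r where "r = r0 / 2"
  have r: "0 < r" "ball a (2 * r) \<subseteq> D" using r0 by (auto simp: r_def)
  obtain C where C: "0 < C" and bd: "\<forall>a f. admissible k m n (ball a (2 * r)) f \<longrightarrow>
           (\<forall>z\<in>ball a (r / 2). cmod (deriv f z) \<le> C * growth (cmod (f z)))"
    using uniform_growth_bound[OF assms(5-8) r(1)] by blast
  show "\<exists>r>0. ball a r \<subseteq> D \<and>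
       (\<forall>T. \<exists>M. \<forall>f\<in>F. \<forall>z\<in>ball a r. \<forall>w\<in>ball a r. cmod (f z) \<le> T \<longrightarrow> cmod (f w) \<le> M)"
  proof (rule exI[of _ "r / 2"], intro conjI allI)
    show sub: "ball a (r / 2) \<subseteq> D" using r by (auto intro: subset_trans[OF subset_ball])
    fix T
    \<comment> \<open>Any two points of the ball are at distance at most \<open>r\<close>, so
      \<open>loggrowth (cmod (f z))\<close> changes by at most the factor exp (4 C r), the same for
      all of F.\<close>
    have "cmod (f w) \<le> exp (exp (4 * C * r) * loggrowth T)"
      if f: "f \<in> F" and z: "z \<in> ball a (r / 2)" and w: "w \<in> ball a (r / 2)" and T: "cmod (f z) \<le> T" for f z w
    proof (rule loggrowth_le_imp_le)
      have "admissible k m n (ball a (2 * r)) f" using adm[OF f] r(2) by (rule admissible_subset)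
      then have "loggrowth (cmod (f w)) \<le> exp (4 * C * cmod (w - z)) * loggrowth (cmod (f z))"
        using bd by (intro loggrowth_Lipschitz[OF holomorphic_on_subset[OF assms(4)[OF f] sub] _ _ _ z w]) auto
      also have "\<dots> \<le> exp (4 * C * r) * loggrowth T"
      proof (intro mult_mono)
        have "dist w z \<le> dist w a + dist a z" by (rule dist_triangle)
        then have "dist w z \<le> r" using z w by (simp add: dist_commute)
        then have "cmod (w - z) \<le> r" by (simp add: dist_norm)
        then show "exp (4 * C * cmod (w - z)) \<le> exp (4 * C * r)" using C by simp
        have "(cmod (f z))\<^sup>2 \<le> T\<^sup>2" using T by (intro power_mono) auto
        then show "loggrowth (cmod (f z)) \<le> loggrowth T" by (simp add: loggrowth_def add_pos_nonneg)
        show "0 \<le> loggrowth (cmod (f z))" using loggrowth_ge_1 by (meson order_trans zero_le_one)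
      qed auto
      finally show "loggrowth (cmod (f w)) \<le> exp (4 * C * r) * loggrowth T" .
    qed
    then show "\<exists>M. \<forall>f\<in>F. \<forall>z\<in>ball a (r / 2). \<forall>w\<in>ball a (r / 2). cmod (f z) \<le> T \<longrightarrow> cmod (f w) \<le> M" by blast
  qed (use r in auto)
qed

end
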